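(* Let $q=p^m$ be an odd prime power, $p$ an odd prime, let $A_{\alpha,0},A_{\alpha,1}$ ($\alpha\in\mathbb{F}_q$) and $A_2$ be the matrices defined in the context, and let $S$ be any subset of $\mathbb{F}_q^*$ such that $S\cup(-S)=\mathbb{F}_q^*$ and $S\cap(-S)=\emptyset$. Then the set of matrices $\{A_{0,0},\ A_{\alpha,0}+A_{-\alpha,0},\ A_{0,1},\ A_{\alpha,1}+A_{-\alpha,1},\ A_2\mid\alpha\in S\}$ forms a symmetric association scheme with the second eigenmatrix $$Q=\begin{pmatrix}\chi_0 & (q^2-1)\chi_0 & q\chi_0 & \frac{q(q+1)}2(\chi_\alpha+\chi_{-\alpha})\\ \chi_0 & \mathbf 0 & -\chi_0 & \frac{q+1}2(\chi_\alpha+\chi_{-\alpha})\\ 1 & -(q+1) & q & 0\end{pmatrix},$$ where $\alpha$ runs over the set $S$.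
   Context: $I_r$, $J_r$: identity and all-ones matrices of order $r$. A set of nonzero $v\times v$ $(0,1)$-matrices $\{A_0,\dots,A_d\}$ is an association scheme if $A_0=I_v$ (for one labelled $A_0$), $\sum_iA_i=J_v$, $A_i^\top\in\{A_1,\dots,A_d\}$ for $i\ge1$, and every product $A_iA_j$ is a linear combination of $A_0,\dots,A_d$; it is symmetric if all $A_i$ are symmetric (it is then commutative). For a symmetric scheme with adjacency matrices $B_0,\dots,B_e$ and primitive idempotents $E_0,\dots,E_e$ of its adjacency algebra (the complex span of the $B_l$), the second eigenmatrix $Q=(q_{l,k})$ is defined by $E_k=\frac1v\sum_lq_{l,k}B_l$. View the additive group of $\mathbb{F}_q$ as $\mathbb{Z}_p^m$. Let $U$ be the $p\times p$ circulant matrix with first row $(0,1,0,\dots,0)$, and $\phi((x_i)_{i=1}^m)=\bigotimes_{i=1}^mU^{x_i}$. For $\alpha,\alpha'\in\mathbb{F}_q$ let $C_{\alpha,\alpha'}=(\phi(\alpha(-\beta+\beta')+\alpha'))_{\beta,\beta'\in\mathbb{F}_q}$, a $q^2\times q^2$ $(0,1)$-matrix made of $q\times q$ blocks. Let $x$ be an indeterminate and $L$ a symmetric Latin square of order $q+1$ on the symbol set $\mathbb{F}_q\cup\{x\}$ with constant diagonal $x$; $P_a$ is the symmetric permutation matrix of order $q+1$ marking the positions of the symbol $a$ in $L$ (so $P_x=I_{q+1}$). Let $R$ be the back identity matrix of order $q^2$ (ones on the anti-diagonal). For $\alpha\in\mathbb{F}_q$ let $N_\alpha=I_{q+1}\otimes(J_{q^2}-I_q\otimes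 J_q)+\sum_{a\in\mathbb{F}_q}P_a\otimes C_{a,\alpha}R$. Define $A_{\alpha,0}=I_{q(q+1)}\otimes\phi(\alpha)$, $A_{\alpha,1}=N_\alpha-I_{q+1}\otimes(J_{q^2}-I_q\otimes J_q)$, $A_2=I_{q+1}\otimes(J_{q^2}-I_q\otimes J_q)$. $\chi_\beta$ ($\beta\in\mathbb{F}_q$) is the irreducible character $\chi_\beta(\gamma)=w^{\langle\gamma,\beta\rangle}$, where $\langle\gamma,\beta\rangle=\gamma_1\beta_1+\dots+\gamma_m\beta_m$ and $w=e^{2\pi\sqrt{-1}/p}$, written as a column vector; $\mathbf 0$ is the zero column vector. The first block row of $Q$ refers to the matrices formed from the $A_{\gamma,0}$, the second to those formed from the $A_{\gamma,1}$, and the last row to $A_2$.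
   Formalization: The displayed Q lacks columns (3+(q-1)/2 for q+2 idempotents); for each α in S the column (q(q+1)/2(χ_α+χ_{-α}), -(q+1)/2(χ_α+χ_{-α}), 0) is added. Row blocks are restricted to {0}∪S, and the blocks of C are ordered lexicographically in Z_p^m. *)

theory Defs
  imports Complex_Main "HOL-Library.Cardinality" "HOL-Computational_Algebra.Primes" "Jordan_Normal_Form.Matrix"
begin

section \<open>Association schemes and second eigenmatrices\<close>

definition all_ones :: "nat \<Rightarrow> complex mat" where
  "all_ones n = mat n n (\<lambda>_. 1)"

definition mat_lincomb :: "nat \<Rightarrow> 'i set \<Rightarrow> ('i \<Rightarrow> complex) \<Rightarrow> ('i \<Rightarrow> complex mat) \<Rightarrow> complex mat" where
  "mat_lincomb v I c A = mat v v (\<lambda>(r, s). \<Sum>i\<in>I. c i * A i $$ (r, s))"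

definition adjacency_algebra :: "nat \<Rightarrow> 'i set \<Rightarrow> ('i \<Rightarrow> complex mat) \<Rightarrow> complex mat set" where
  "adjacency_algebra v I A = range (\<lambda>c. mat_lincomb v I c A)"

text \<open>
  The set of matrices is given as a family indexed by a finite set \<open>I\<close>, with \<open>i0\<close> the index
  of the identity matrix. The members of the family are automatically distinct, since they are
  nonzero (0,1)-matrices whose sum is the all-ones matrix.
\<close>

definition association_scheme :: "nat \<Rightarrow> 'i set \<Rightarrow> 'i \<Rightarrow> ('i \<Rightarrow> complex mat) \<Rightarrow> bool" where
  "association_scheme v I i0 A \<longleftrightarrow>
     finite I \<and> i0 \<in> I \<and>
     (\<forall>i\<in>I. A i \<in> carrier_mat v v \<and> A i \<noteq> 0\<^sub>m v v \<and>
        (\<forall>r<v. \<forall>s<v. A i $$ (r, s) = 0 \<or> A i $$ (r, s) = 1)) \<and>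
     A i0 = 1\<^sub>m v \<and>
     mat_lincomb v I (\<lambda>_. 1) A = all_ones v \<and>
     (\<forall>i\<in>I - {i0}. \<exists>j\<in>I - {i0}. transpose_mat (A i) = A j) \<and>
     (\<forall>i\<in>I. \<forall>j\<in>I. A i * A j \<in> adjacency_algebra v I A)"

definition symmetric_association_scheme ::
  "nat \<Rightarrow> 'i set \<Rightarrow> 'i \<Rightarrow> ('i \<Rightarrow> complex mat) \<Rightarrow> bool" where
  "symmetric_association_scheme v I i0 A \<longleftrightarrow>
     association_scheme v I i0 A \<and> (\<forall>i\<in>I. transpose_mat (A i) = A i)"

definition primitive_idempotent :: "nat \<Rightarrow> complex mat set \<Rightarrow> complex mat \<Rightarrow> bool" where
  "primitive_idempotent v \<A> E \<longleftrightarrow>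
     E \<in> \<A> \<and> E \<noteq> 0\<^sub>m v v \<and> E * E = E \<and>
     \<not> (\<exists>F\<in>\<A>. \<exists>G\<in>\<A>. F \<noteq> 0\<^sub>m v v \<and> G \<noteq> 0\<^sub>m v v \<and> F * F = F \<and> G * G = G \<and>
          F * G = 0\<^sub>m v v \<and> G * F = 0\<^sub>m v v \<and> E = F + G)"

text \<open>
  Rows are indexed by the classes \<open>I\<close>, columns by a set \<open>K\<close> labelling all the primitive
  idempotents, each of them exactly once.
\<close>

definition second_eigenmatrix ::
  "nat \<Rightarrow> 'i set \<Rightarrow> ('i \<Rightarrow> complex mat) \<Rightarrow> 'k set \<Rightarrow> ('i \<Rightarrow> 'k \<Rightarrow> complex) \<Rightarrow> bool" where
  "second_eigenmatrix v I B K Q \<longleftrightarrow>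
     (\<exists>E. bij_betw E K {X. primitive_idempotent v (adjacency_algebra v I B) X} \<and>
          (\<forall>k\<in>K. E k = (1 / of_nat v) \<cdot>\<^sub>m mat_lincomb v I (\<lambda>l. Q l k) B))"


section \<open>The matrices $\phi(\alpha)$ and $C_{\alpha,\alpha'}$\<close>

definition kron :: "complex mat \<Rightarrow> complex mat \<Rightarrow> complex mat" (infixr "\<otimes>\<^sub>m" 71) where
  "A \<otimes>\<^sub>m B = mat (dim_row A * dim_row B) (dim_col A * dim_col B)
     (\<lambda>(i, j). A $$ (i div dim_row B, j div dim_col B) * B $$ (i mod dim_row B, j mod dim_col B))"

text \<open>
  An identification of the additive group of the field \<open>'a\<close> with \<open>\<int>\<^sub>p\<^sup>m\<close>; an element of
  \<open>\<int>\<^sub>p\<^sup>m\<close> is written as the list of its \<open>m\<close> coordinates, represented in \<open>{0..<p}\<close>.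
\<close>

definition additive_coords :: "nat \<Rightarrow> nat \<Rightarrow> ('a::ab_group_add \<Rightarrow> nat list) \<Rightarrow> bool" where
  "additive_coords p m crd \<longleftrightarrow>
     bij_betw crd UNIV {xs. length xs = m \<and> set xs \<subseteq> {..<p}} \<and>
     (\<forall>x y. \<forall>i<m. crd (x + y) ! i = (crd x ! i + crd y ! i) mod p)"

definition circ :: "nat \<Rightarrow> complex mat" where
  "circ p = mat p p (\<lambda>(i, j). if j = (i + 1) mod p then 1 else 0)"

definition phi :: "nat \<Rightarrow> ('a \<Rightarrow> nat list) \<Rightarrow> 'a \<Rightarrow> complex mat" where
  "phi p crd x = foldr (\<otimes>\<^sub>m) (map (\<lambda>k. circ p ^\<^sub>m k) (crd x)) (1\<^sub>m 1)"

text \<open>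
  Block rows and block columns indexed by the field are arranged in lexicographic order of the
  coordinates, i.e. in the order in which the Kronecker product in \<open>phi\<close> arranges \<open>\<int>\<^sub>p\<^sup>m\<close>.
  The position of \<open>x\<close> is thus the number with base-\<open>p\<close> digits \<open>crd x\<close>, most significant digit
  first. The order matters because of the product with the back identity matrix below.
\<close>

definition lex_pos :: "nat \<Rightarrow> ('a \<Rightarrow> nat list) \<Rightarrow> 'a \<Rightarrow> nat" where
  "lex_pos p crd x = foldl (\<lambda>n d. n * p + d) 0 (crd x)"

definition lex_elem :: "nat \<Rightarrow> ('a \<Rightarrow> nat list) \<Rightarrow> nat \<Rightarrow> 'a" where
  "lex_elem p crd = the_inv (lex_pos p crd)"

definition Cmat :: "nat \<Rightarrow> ('a::{field,finite} \<Rightarrow> nat list) \<Rightarrow> 'a \<Rightarrow> 'a \<Rightarrow> complex mat" where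
  "Cmat p crd \<alpha> \<alpha>' = (let q = CARD('a) in
     mat (q^2) (q^2) (\<lambda>(i, j).
       phi p crd (\<alpha> * (- lex_elem p crd (i div q) + lex_elem p crd (j div q)) + \<alpha>')
         $$ (i mod q, j mod q)))"


section \<open>The matrices $A_{\alpha,0}$, $A_{\alpha,1}$, $A_2$\<close>

text \<open>
  Latin squares with symbol set the whole type. Below the symbol type is \<open>'a option\<close>: \<open>Some a\<close>
  stands for the field element \<open>a\<close> and \<open>None\<close> for the indeterminate.
\<close>

definition latin_square :: "nat \<Rightarrow> 's mat \<Rightarrow> bool" where
  "latin_square n L \<longleftrightarrow> L \<in> carrier_mat n n \<and>
     (\<forall>i<n. bij_betw (\<lambda>j. L $$ (i, j)) {..<n} UNIV) \<and>
     (\<forall>j<n. bij_betw (\<lambda>i. L $$ (i, j)) {..<n} UNIV)"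

definition symbol_mat :: "'s mat \<Rightarrow> 's \<Rightarrow> complex mat" where
  "symbol_mat L s = mat (dim_row L) (dim_col L) (\<lambda>(i, j). if L $$ (i, j) = s then 1 else 0)"

definition back_identity :: "nat \<Rightarrow> complex mat" where
  "back_identity n = mat n n (\<lambda>(i, j). if i + j = n - 1 then 1 else 0)"

definition A0 :: "nat \<Rightarrow> ('a::{field,finite} \<Rightarrow> nat list) \<Rightarrow> 'a \<Rightarrow> complex mat" where
  "A0 p crd \<alpha> = (let q = CARD('a) in 1\<^sub>m (q * (q + 1)) \<otimes>\<^sub>m phi p crd \<alpha>)"

definition A2 :: "'a::{field,finite} itself \<Rightarrow> complex mat" where
  "A2 _ = (let q = CARD('a) in
     1\<^sub>m (q + 1) \<otimes>\<^sub>m (all_ones (q^2) - 1\<^sub>m q \<otimes>\<^sub>m all_ones q))"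

definition Nmat ::
  "nat \<Rightarrow> ('a::{field,finite} \<Rightarrow> nat list) \<Rightarrow> 'a option mat \<Rightarrow> 'a \<Rightarrow> complex mat" where
  "Nmat p crd L \<alpha> = (let q = CARD('a) in
     A2 TYPE('a) +
     mat_lincomb (q^2 * (q + 1)) UNIV (\<lambda>_. 1)
       (\<lambda>a. symbol_mat L (Some a) \<otimes>\<^sub>m (Cmat p crd a \<alpha> * back_identity (q^2))))"

definition A1 ::
  "nat \<Rightarrow> ('a::{field,finite} \<Rightarrow> nat list) \<Rightarrow> 'a option mat \<Rightarrow> 'a \<Rightarrow> complex mat" where
  "A1 p crd L \<alpha> = Nmat p crd L \<alpha> - A2 TYPE('a)"


section \<open>The symmetric scheme and its second eigenmatrix\<close>

datatype 'a cls = Cls0 'a | Cls1 'a | Cls2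

definition scheme_index :: "'a::zero set \<Rightarrow> 'a cls set" where
  "scheme_index S = Cls0 ` insert 0 S \<union> Cls1 ` insert 0 S \<union> {Cls2}"

fun class_mat ::
  "nat \<Rightarrow> ('a::{field,finite} \<Rightarrow> nat list) \<Rightarrow> 'a option mat \<Rightarrow> 'a cls \<Rightarrow> complex mat" where
  "class_mat p crd L (Cls0 \<alpha>) = (if \<alpha> = 0 then A0 p crd 0 else A0 p crd \<alpha> + A0 p crd (- \<alpha>))"
| "class_mat p crd L (Cls1 \<alpha>) = (if \<alpha> = 0 then A1 p crd L 0 else A1 p crd L \<alpha> + A1 p crd L (- \<alpha>))"
| "class_mat p crd L Cls2 = A2 TYPE('a)"

definition chi :: "nat \<Rightarrow> ('a \<Rightarrow> nat list) \<Rightarrow> 'a \<Rightarrow> 'a \<Rightarrow> complex" where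
  "chi p crd \<beta> \<gamma> =
     exp (2 * of_real pi * \<i> / of_nat p) ^ (\<Sum>i<length (crd \<gamma>). crd \<gamma> ! i * crd \<beta> ! i)"

text \<open>
  A scheme with \<open>q + 2\<close> symmetric classes has \<open>q + 2\<close> primitive idempotents, whereas the columns
  $(\chi_0, \chi_0, 1)$, $((q^2-1)\chi_0, \mathbf{0}, -(q+1))$, $(q\chi_0, -\chi_0, q)$ and
  $(\frac{q(q+1)}{2}(\chi_\alpha+\chi_{-\alpha}), \frac{q+1}{2}(\chi_\alpha+\chi_{-\alpha}), 0)$
  for $\alpha\in S$ number only $(q+5)/2$. The eigenmatrix has, for every $\alpha\in S$, also the
  column with the opposite sign in the second block row. \<open>ColPlus\<close> and \<open>ColMinus\<close> label the
  columns with the two signs.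
\<close>

datatype 'a col = Col0 | Col1 | Col2 | ColPlus 'a | ColMinus 'a

definition columns :: "'a set \<Rightarrow> 'a col set" where
  "columns S = {Col0, Col1, Col2} \<union> ColPlus ` S \<union> ColMinus ` S"

fun Qmat :: "nat \<Rightarrow> ('a::{field,finite} \<Rightarrow> nat list) \<Rightarrow> 'a cls \<Rightarrow> 'a col \<Rightarrow> complex" where
  "Qmat p crd (Cls0 \<gamma>) Col0 = chi p crd 0 \<gamma>"
| "Qmat p crd (Cls0 \<gamma>) Col1 = (of_nat CARD('a)^2 - 1) * chi p crd 0 \<gamma>"
| "Qmat p crd (Cls0 \<gamma>) Col2 = of_nat CARD('a) * chi p crd 0 \<gamma>"
| "Qmat p crd (Cls0 \<gamma>) (ColPlus \<alpha>) =
     of_nat CARD('a) * (of_nat CARD('a) + 1) / 2 * (chi p crd \<alpha> \<gamma> + chi p crd (- \<alpha>) \<gamma>)"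
| "Qmat p crd (Cls0 \<gamma>) (ColMinus \<alpha>) =
     of_nat CARD('a) * (of_nat CARD('a) + 1) / 2 * (chi p crd \<alpha> \<gamma> + chi p crd (- \<alpha>) \<gamma>)"
| "Qmat p crd (Cls1 \<gamma>) Col0 = chi p crd 0 \<gamma>"
| "Qmat p crd (Cls1 \<gamma>) Col1 = 0"
| "Qmat p crd (Cls1 \<gamma>) Col2 = - chi p crd 0 \<gamma>"
| "Qmat p crd (Cls1 \<gamma>) (ColPlus \<alpha>) =
     (of_nat CARD('a) + 1) / 2 * (chi p crd \<alpha> \<gamma> + chi p crd (- \<alpha>) \<gamma>)"
| "Qmat p crd (Cls1 \<gamma>) (ColMinus \<alpha>) =
     - ((of_nat CARD('a) + 1) / 2) * (chi p crd \<alpha> \<gamma> + chi p crd (- \<alpha>) \<gamma>)"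
| "Qmat p crd Cls2 Col0 = 1"
| "Qmat p crd Cls2 Col1 = - (of_nat CARD('a) + 1)"
| "Qmat p crd Cls2 Col2 = of_nat CARD('a)"
| "Qmat p crd Cls2 (ColPlus \<alpha>) = 0"
| "Qmat p crd Cls2 (ColMinus \<alpha>) = 0"

end

theory Submission
  imports Defs
begin

text \<open>
  Number the vertices \<open>0, \<dots>, q\<^sup>2(q + 1) - 1\<close> by triples \<open>(u, b, y)\<close> with \<open>u \<le> q\<close> (the \<^emph>\<open>group\<close>)
  and \<open>b\<close>, \<open>y\<close> in the field; the vertices with equal \<open>u\<close> and \<open>b\<close> form a \<^emph>\<open>fibre\<close>. The matrix
  \<open>A\<^bsub>\<alpha>,0\<^esub>\<close> relates \<open>(u, b, y)\<close> to \<open>(u, b, y + \<alpha>)\<close>, and \<open>A\<^sub>2\<close> relates vertices of the same group in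
  different fibres. Multiplication by the back identity reverses the order of the columns of a
  block, and reversing the lexicographic order is the map \<open>z \<mapsto> c - z\<close>, where all coordinates of \<open>c\<close>
  are \<open>p - 1\<close>. Hence \<open>A\<^bsub>\<alpha>,1\<^esub>\<close> relates \<open>(u, b, y)\<close> to \<open>(u', b', y')\<close> for \<open>u \<noteq> u'\<close> precisely if
  \<open>(1 - a) c + a (b + b') - y - y' = \<alpha>\<close>, where \<open>a\<close> is the symbol of the Latin square at \<open>(u, u')\<close>.

  All matrices \<open>\<Sum>\<^sub>\<gamma> f(\<gamma>) A\<^bsub>\<gamma>,0\<^esub> + \<Sum>\<^sub>\<gamma> g(\<gamma>) A\<^bsub>\<gamma>,1\<^esub> + h A\<^sub>2\<close> are therefore of one shape, \<open>coef_mat (f, g, h)\<close>,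
  and the product of two of them is again of this shape, with coefficients \<open>coef_mult\<close>
  (\<open>coef_mat_mult\<close>). Besides the symmetry of the Latin square, two properties of it make this work:
  a row takes every field element exactly once off the diagonal, and two rows differ in each column.
  As the span of the classes of the theorem consists of the \<open>coef_mat (f, g, h)\<close> with \<open>f\<close> and \<open>g\<close> even (\<open>adjacency_algebra_eq\<close>),
  and evenness survives \<open>coef_mult\<close>, the scheme axioms follow.

  The product involves \<open>f\<close> and \<open>g\<close> only through convolutions, correlations and total sums, so the
  Fourier transform diagonalises it. For even coefficients this gives \<open>q + 2\<close> multiplicative
  functionals \<open>ev k\<close>, one for each column of the eigenmatrix (\<open>ev_mult\<close>), which together determine
  the coefficients, by Fourier inversion (\<open>ev_inj\<close>). So the adjacency algebra is a product of
  \<open>q + 2\<close> copies of the complex numbers, and its primitive idempotents are the dual basis of these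
  functionals. By the orthogonality of characters, the columns of \<open>Q\<close>, divided by the order of
  the matrices, are the coefficients of this dual basis (\<open>ev_col_coef\<close>).
\<close>

section \<open>Values of digit lists\<close>

definition digits_value :: "nat \<Rightarrow> nat list \<Rightarrow> nat" where
  "digits_value p xs = foldl (\<lambda>n d. n * p + d) 0 xs"

lemma digits_value_Nil [simp]: "digits_value p [] = 0"
  by (simp add: digits_value_def)

lemma digits_value_Cons [simp]:
  "digits_value p (x # xs) = x * p ^ length xs + digits_value p xs"
proof -
  have "foldl (\<lambda>n d. n * p + d) a xs = a * p ^ length xs + foldl (\<lambda>n d. n * p + d) 0 xs" for a
  proof (induction xs arbitrary: a)
    case (Cons y ys)
    show ?case
      using Cons.IH[of "a * p + y"] Cons.IH[of y] by (simp add: algebra_simps)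
  qed simp
  from this[of x] show ?thesis by (simp add: digits_value_def)
qed

lemma digits_value_less:
  "set xs \<subseteq> {..<p} \<Longrightarrow> digits_value p xs < p ^ length xs"
proof (induction xs)
  case (Cons x xs)
  then have "x * p ^ length xs + digits_value p xs < Suc x * p ^ length xs" by simp
  also have "\<dots> \<le> p * p ^ length xs" using Cons.prems by (intro mult_right_mono) auto
  finally show ?case by simp
qed simp

lemma digits_value_inj:
  assumes "length xs = length ys" "set xs \<subseteq> {..<p}" "set ys \<subseteq> {..<p}"
    and "digits_value p xs = digits_value p ys"
  shows "xs = ys"
  using assms
proof (induction xs ys rule: list_induct2)
  case (Cons x xs y ys)
  have less: "digits_value p xs < p ^ length xs" "digits_value p ys < p ^ length xs"
    using digits_value_less[of xs p] digits_value_less[of ys p] Cons by auto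
  then have nonzero: "p ^ length xs \<noteq> 0" by linarith
  have eq: "x * p ^ length xs + digits_value p xs = y * p ^ length xs + digits_value p ys"
    using Cons by simp
  have "x = (x * p ^ length xs + digits_value p xs) div p ^ length xs"
    using less(1) nonzero by (metis add.right_neutral div_less div_mult_self3)
  also have "\<dots> = y" unfolding eq using less(2) nonzero by (metis add.right_neutral div_less div_mult_self3)
  finally have "x = y" .
  with Cons eq show ?case by auto
qed simp

text \<open>
  Replacing every digit \<open>d\<close> by \<open>p - 1 - d\<close> reverses the order of the numbers below \<open>p ^ n\<close>. This is how
  the back identity acts on the coordinates of a vertex.
\<close>

lemma digits_value_complement:
  assumes "0 < p" "set xs \<subseteq> {..<p}"
  shows "digits_value p (map (\<lambda>d. p - 1 - d) xs) + digits_value p xs = p ^ length xs - 1"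
  using assms(2)
proof (induction xs)
  case (Cons x xs)
  have "digits_value p (map (\<lambda>d. p - 1 - d) (x # xs)) + digits_value p (x # xs)
      = (p - 1 - x + x) * p ^ length xs
        + (digits_value p (map (\<lambda>d. p - 1 - d) xs) + digits_value p xs)"
    by (simp add: add_mult_distrib)
  also have "\<dots> = (p - 1) * p ^ length xs + (p ^ length xs - 1)"
    using Cons by simp
  also have "\<dots> = p * p ^ length xs - 1"
    using assms(1) by (cases p) auto
  finally show ?case by simp
qed simp


section \<open>Kronecker products of powers of the circulant\<close>

lemma circ_pow_carrier: "circ p ^\<^sub>m k \<in> carrier_mat p p"
  by (rule pow_carrier_mat) (simp add: circ_def)

lemma circ_pow_entry:
  assumes "i < p" "j < p"
  shows "(circ p ^\<^sub>m k) $$ (i, j) = (if j = (i + k) mod p then 1 else 0)"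
  using assms(2)
proof (induction k arbitrary: j)
  case 0
  then show ?case using assms(1) by (auto simp: circ_def)
next
  case (Suc k)
  have C: "circ p \<in> carrier_mat p p" by (simp add: circ_def)
  have "(circ p ^\<^sub>m Suc k) $$ (i, j) = (\<Sum>l<p. (circ p ^\<^sub>m k) $$ (i, l) * circ p $$ (l, j))"
    using circ_pow_carrier[of p k] C assms(1) Suc.prems
    by (simp add: scalar_prod_def atLeast0LessThan)
  also have "\<dots> = (\<Sum>l<p. if l = (i + k) mod p then circ p $$ (l, j) else 0)"
    by (rule sum.cong) (auto simp: Suc.IH)
  also have "\<dots> = circ p $$ ((i + k) mod p, j)"
    using assms(1) by simp
  also have "\<dots> = (if j = (i + Suc k) mod p then 1 else 0)"
    using assms(1) Suc.prems by (simp add: circ_def mod_Suc_eq)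
  finally show ?case .
qed

lemma kron_carrier:
  "A \<in> carrier_mat r s \<Longrightarrow> B \<in> carrier_mat r' s' \<Longrightarrow> A \<otimes>\<^sub>m B \<in> carrier_mat (r * r') (s * s')"
  by (simp add: kron_def)

lemma kron_index:
  assumes "A \<in> carrier_mat r s" "B \<in> carrier_mat r' s'" "i < r * r'" "j < s * s'"
  shows "(A \<otimes>\<^sub>m B) $$ (i, j) = A $$ (i div r', j div s') * B $$ (i mod r', j mod s')"
  using assms by (simp add: kron_def)

lemma kron_entry:
  assumes "A \<in> carrier_mat r s" "B \<in> carrier_mat r' s'"
    and "i < r" "j < s" "i' < r'" "j' < s'"
  shows "(A \<otimes>\<^sub>m B) $$ (i * r' + i', j * s' + j') = A $$ (i, j) * B $$ (i', j')"
proof -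
  have "i * r' + i' < Suc i * r'" using assms by simp
  also have "\<dots> \<le> r * r'" using assms by (intro mult_right_mono) auto
  finally have "i * r' + i' < r * r'" .
  moreover have "j * s' + j' < Suc j * s'" using assms by simp
  then have "j * s' + j' < s * s'" using assms(4) mult_right_mono[of "Suc j" s s'] by simp
  ultimately show ?thesis using assms by (simp add: kron_def)
qed

lemma foldr_kron_circ_carrier:
  "foldr (\<otimes>\<^sub>m) (map (\<lambda>k. circ p ^\<^sub>m k) xs) (1\<^sub>m 1) \<in> carrier_mat (p ^ length xs) (p ^ length xs)"
proof (induction xs)
  case (Cons x xs)
  from kron_carrier[OF circ_pow_carrier[of p x] this] show ?case by simp
qed simp

text \<open>
  The position of a digit list in a Kronecker product is its value, so an entry of the product is
  the product over the digits of entries of circulant powers.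
\<close>

lemma foldr_kron_circ_entry:
  assumes "length xs = length ys" "length ys = length zs"
    and "set ys \<subseteq> {..<p}" "set zs \<subseteq> {..<p}"
  shows "foldr (\<otimes>\<^sub>m) (map (\<lambda>k. circ p ^\<^sub>m k) xs) (1\<^sub>m 1) $$ (digits_value p ys, digits_value p zs)
    = (if \<forall>i<length xs. zs ! i = (ys ! i + xs ! i) mod p then 1 else 0)"
  using assms
proof (induction xs ys zs rule: list_induct3)
  case (Cons x xs y ys z zs)
  have "foldr (\<otimes>\<^sub>m) (map (\<lambda>k. circ p ^\<^sub>m k) (x # xs)) (1\<^sub>m 1)
      $$ (digits_value p (y # ys), digits_value p (z # zs))
    = (circ p ^\<^sub>m x) $$ (y, z)
      * foldr (\<otimes>\<^sub>m) (map (\<lambda>k. circ p ^\<^sub>m k) xs) (1\<^sub>m 1) $$ (digits_value p ys, digits_value p zs)"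
    using kron_entry[OF circ_pow_carrier[of p x] foldr_kron_circ_carrier[of p xs],
        where i = y and j = z and i' = "digits_value p ys" and j' = "digits_value p zs"]
      digits_value_less[of ys p] digits_value_less[of zs p] Cons by simp
  also have "\<dots> = (if z = (y + x) mod p \<and> (\<forall>i<length xs. zs ! i = (ys ! i + xs ! i) mod p) then 1 else 0)"
    using Cons by (simp add: circ_pow_entry)
  finally show ?case by (simp add: All_less_Suc2)
qed simp


section \<open>The additive group of the field and its characters\<close>

locale coordinates =
  fixes p m :: nat and crd :: "'a::{field,finite} \<Rightarrow> nat list"
  assumes p_gt_1: "1 < p" and coords: "additive_coords p m crd"
begin

lemma length_crd [simp]: "length (crd x) = m"
  and set_crd: "set (crd x) \<subseteq> {..<p}"
  using coords bij_betwE[of crd UNIV] unfolding additive_coords_def by blast+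

lemma crd_less: "i < m \<Longrightarrow> crd x ! i < p"
  using set_crd[of x] nth_mem[of i "crd x"] by (auto simp del: nth_mem)

lemma crd_add: "i < m \<Longrightarrow> crd (x + y) ! i = (crd x ! i + crd y ! i) mod p"
  using coords unfolding additive_coords_def by blast

lemma crd_eqI: "(\<And>i. i < m \<Longrightarrow> crd x ! i = crd y ! i) \<Longrightarrow> x = y"
proof -
  assume "\<And>i. i < m \<Longrightarrow> crd x ! i = crd y ! i"
  then have "crd x = crd y" by (intro nth_equalityI) auto
  moreover have "inj crd" using coords unfolding additive_coords_def bij_betw_def by blast
  ultimately show "x = y" by (simp add: inj_eq)
qed

lemma crd_surj:
  assumes "length xs = m" "set xs \<subseteq> {..<p}"
  shows "\<exists>x. crd x = xs"
  using assms coords unfolding additive_coords_def bij_betw_def by (metis (mono_tags, lifting) imageE mem_Collect_eq)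

lemma card_field: "CARD('a) = p ^ m"
proof -
  have "CARD('a) = card {xs. set xs \<subseteq> {..<p} \<and> length xs = m}"
    using coords bij_betw_same_card[of crd UNIV] unfolding additive_coords_def
    by (metis (no_types, lifting) Collect_cong)
  then show ?thesis by (simp add: card_lists_length_eq)
qed

lemma lex_pos_digits: "lex_pos p crd x = digits_value p (crd x)"
  by (simp add: lex_pos_def digits_value_def)

lemma lex_pos_less: "lex_pos p crd x < CARD('a)"
  using digits_value_less[OF set_crd, of x] by (simp add: lex_pos_digits card_field)

lemma bij_lex_pos: "bij_betw (lex_pos p crd) UNIV {..<CARD('a)}"
proof -
  have "inj (lex_pos p crd)"
    by (rule injI) (metis crd_eqI digits_value_inj length_crd lex_pos_digits set_crd)
  moreover from this have "range (lex_pos p crd) = {..<CARD('a)}"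
    by (intro card_subset_eq) (auto simp: lex_pos_less card_image)
  ultimately show ?thesis by (simp add: bij_betw_def)
qed

lemma lex_elem_pos [simp]: "lex_elem p crd (lex_pos p crd x) = x"
  unfolding lex_elem_def using bij_lex_pos by (simp add: bij_betw_def the_inv_f_f)

lemma lex_pos_elem: "n < CARD('a) \<Longrightarrow> lex_pos p crd (lex_elem p crd n) = n"
  using bij_lex_pos lex_elem_pos unfolding bij_betw_def by (metis imageE lessThan_iff)

lemma phi_carrier: "phi p crd x \<in> carrier_mat CARD('a) CARD('a)"
  using foldr_kron_circ_carrier[of p "crd x"] by (simp add: phi_def card_field)

lemma phi_entry:
  "phi p crd x $$ (lex_pos p crd y, lex_pos p crd z) = (if z = y + x then 1 else 0)"
proof -
  have "(\<forall>i<m. crd z ! i = (crd y ! i + crd x ! i) mod p) \<longleftrightarrow> z = y + x"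
    using crd_eqI[of z "y + x"] crd_add[of _ y x] by auto
  then show ?thesis
    using foldr_kron_circ_entry[of "crd x" "crd y" "crd z" p]
    by (simp add: phi_def lex_pos_digits set_crd)
qed

lemma phi_entry_elem:
  assumes "i < CARD('a)" "j < CARD('a)"
  shows "phi p crd x $$ (i, j) = (if lex_elem p crd j = lex_elem p crd i + x then 1 else 0)"
  using phi_entry[of x "lex_elem p crd i" "lex_elem p crd j"] assms by (simp add: lex_pos_elem)

text \<open>
  The element \<open>c\<close> whose coordinates are all \<open>p - 1\<close>. It comes last in the lexicographic order, and
  \<open>z \<mapsto> c - z\<close> complements all digits, because no carry occurs.
\<close>

definition top_elem :: 'a where
  "top_elem = (THE c. crd c = replicate m (p - 1))"

lemma crd_top: "crd top_elem = replicate m (p - 1)"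
proof -
  obtain c where c: "crd c = replicate m (p - 1)"
    using crd_surj[of "replicate m (p - 1)"] p_gt_1 by fastforce
  then show ?thesis unfolding top_elem_def
    by (rule theI) (use c crd_eqI in auto)
qed

lemma lex_pos_top_minus:
  "lex_pos p crd (top_elem - x) = CARD('a) - 1 - lex_pos p crd x"
proof -
  \<comment> \<open>The element with the complementary digits is the difference.\<close>
  obtain y where y: "crd y = map (\<lambda>d. p - 1 - d) (crd x)"
    using crd_surj[of "map (\<lambda>d. p - 1 - d) (crd x)"] p_gt_1 by fastforce
  have "crd (x + y) ! i = crd top_elem ! i" if "i < m" for i
    using that crd_add[OF that, of x y] crd_less[OF that, of x] p_gt_1
    by (simp add: y crd_top)
  then have "x + y = top_elem" by (rule crd_eqI)
  then have "y = top_elem - x" by (simp add: algebra_simps)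
  moreover have "lex_pos p crd y + lex_pos p crd x = CARD('a) - 1"
    using digits_value_complement[OF _ set_crd, of x] p_gt_1
    by (simp add: lex_pos_digits y card_field)
  ultimately show ?thesis by simp
qed

lemma lex_elem_complement:
  "n < CARD('a) \<Longrightarrow> lex_elem p crd (CARD('a) - 1 - n) = top_elem - lex_elem p crd n"
  using lex_pos_top_minus[of "lex_elem p crd n"] lex_elem_pos[of "top_elem - lex_elem p crd n"]
  by (simp add: lex_pos_elem)


abbreviation \<chi> :: "'a \<Rightarrow> 'a \<Rightarrow> complex" where "\<chi> \<equiv> chi p crd"

abbreviation root_p :: complex where "root_p \<equiv> exp (2 * of_real pi * \<i> / of_nat p)"

lemma root_p_power: "root_p ^ k = cis (2 * pi * real k / real p)"
  by (simp add: cis_conv_exp algebra_simps flip: exp_of_nat_mult)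

lemma root_p_power_p: "root_p ^ p = 1"
  using p_gt_1 by (simp only: root_p_power) (simp add: cis_multiple_2pi)

lemma root_p_power_mod: "root_p ^ (k mod p * l) = root_p ^ (k * l)"
proof -
  have "root_p ^ k = root_p ^ (p * (k div p) + k mod p)" by simp
  also have "\<dots> = root_p ^ (k mod p)"
    unfolding power_add power_mult root_p_power_p by simp
  finally show ?thesis unfolding power_mult by simp
qed

lemma root_p_power_neq_1:
  assumes "0 < k" "k < p"
  shows "root_p ^ k \<noteq> 1"
proof
  assume "root_p ^ k = 1"
  then have "cis (2 * pi * real k / real p) = cis (2 * pi * real 0 / real p)"
    by (simp add: root_p_power)
  moreover have "inj_on (\<lambda>k. cis (2 * pi * real k / real p)) {..<p}"
    using bij_betw_roots_unity[of p] p_gt_1 by (simp add: bij_betw_def)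
  ultimately have "k = 0" using assms by (elim inj_onD) auto
  with assms show False by simp
qed

lemma chi_prod: "\<chi> \<beta> \<gamma> = (\<Prod>i<m. root_p ^ (crd \<gamma> ! i * crd \<beta> ! i))"
  by (simp add: chi_def power_sum)

lemma chi_commute: "\<chi> \<beta> \<gamma> = \<chi> \<gamma> \<beta>"
  by (simp add: chi_prod mult.commute)

lemma chi_add: "\<chi> \<beta> (\<gamma> + \<delta>) = \<chi> \<beta> \<gamma> * \<chi> \<beta> \<delta>"
  unfolding chi_prod prod.distrib[symmetric]
  by (rule prod.cong) (auto simp: crd_add root_p_power_mod add_mult_distrib power_add)

lemma chi_add_left: "\<chi> (\<beta> + \<beta>') \<gamma> = \<chi> \<beta> \<gamma> * \<chi> \<beta>' \<gamma>"
  by (metis chi_add chi_commute)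

lemma chi_nonzero: "\<chi> \<beta> \<gamma> \<noteq> 0"
  by (simp add: chi_prod)

lemma chi_0_right [simp]: "\<chi> \<beta> 0 = 1"
  using chi_add[of \<beta> 0 0] chi_nonzero[of \<beta> 0] by simp

lemma chi_0_left [simp]: "\<chi> 0 \<gamma> = 1"
  using chi_commute[of 0 \<gamma>] by simp

lemma chi_minus_left: "\<chi> (- \<beta>) \<gamma> = \<chi> \<beta> (- \<gamma>)"
  using chi_add_left[of \<beta> "- \<beta>" \<gamma>] chi_add[of \<beta> \<gamma> "- \<gamma>"] chi_nonzero[of \<beta> \<gamma>]
  by (metis add.right_inverse chi_0_left chi_0_right mult_left_cancel)

text \<open>
  A nontrivial character has a value different from 1 at some \<open>z\<close>, and translating by \<open>z\<close> multiplies
  the sum by that value.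
\<close>

lemma sum_chi: "(\<Sum>\<gamma>\<in>UNIV. \<chi> \<beta> \<gamma>) = (if \<beta> = 0 then of_nat CARD('a) else 0)"
proof (cases "\<beta> = 0")
  case False
  obtain k where k: "k < m" "crd \<beta> ! k \<noteq> crd 0 ! k"
    using crd_eqI[of \<beta> 0] False by auto
  \<comment> \<open>The unit vector in a direction in which \<open>\<beta>\<close> has a nonzero coordinate detects \<open>\<beta>\<close>.\<close>
  obtain z where z: "crd z = (replicate m 0)[k := 1]"
    using crd_surj[of "(replicate m 0)[k := 1]"] p_gt_1 set_update_subset_insert[of "replicate m 0" k 1]
    by (fastforce simp: subset_iff)
  \<comment> \<open>A digit \<open>d < p\<close> with \<open>d = 2 d mod p\<close> is zero.\<close>
  have crd0: "crd 0 ! k = 0"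
    using crd_add[OF k(1), of 0 0] crd_less[OF k(1), of 0]
    by (cases "crd 0 ! k + crd 0 ! k < p") (auto simp: mod_if split: if_splits)
  have "\<chi> \<beta> z = (\<Prod>i<m. if i = k then root_p ^ (crd \<beta> ! k) else 1)"
    unfolding chi_prod by (rule prod.cong) (use k(1) in \<open>auto simp: z nth_list_update\<close>)
  then have z1: "\<chi> \<beta> z \<noteq> 1"
    using k crd0 root_p_power_neq_1[of "crd \<beta> ! k"] crd_less[OF k(1), of \<beta>] by simp
  have "(\<Sum>\<gamma>\<in>UNIV. \<chi> \<beta> \<gamma>) = (\<Sum>\<gamma>\<in>UNIV. \<chi> \<beta> (\<gamma> + z))"
    by (rule sum.reindex_bij_witness[of _ "\<lambda>\<gamma>. \<gamma> + z" "\<lambda>\<gamma>. \<gamma> - z"]) auto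
  also have "\<dots> = \<chi> \<beta> z * (\<Sum>\<gamma>\<in>UNIV. \<chi> \<beta> \<gamma>)"
    by (simp add: chi_add sum_distrib_left mult.commute)
  finally show ?thesis using z1 False by simp
qed simp

end


section \<open>Multiplication of the matrices spanned by the three kinds of classes\<close>

lemma sum_single_exception:
  fixes A C :: complex
  shows "(\<Sum>b2\<in>UNIV. if b2 = (b::'a::finite) then A else C) = A + (of_nat CARD('a) - 1) * C"
proof -
  have "(\<Sum>b2\<in>UNIV. if b2 = b then A else C) = (\<Sum>b2\<in>UNIV. C + (if b2 = b then A - C else 0))"
    by (rule sum.cong) auto
  then show ?thesis by (simp add: sum.distrib algebra_simps)
qed

lemma sum_two_exceptions:
  fixes A B C :: complex
  assumes "(b::'a::finite) \<noteq> b'"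
  shows "(\<Sum>b2\<in>UNIV. if b2 = b then A else if b2 = b' then B else C)
    = A + B + (of_nat CARD('a) - 2) * C"
proof -
  have "(\<Sum>b2\<in>UNIV. if b2 = b then A else if b2 = b' then B else C)
      = (\<Sum>b2\<in>UNIV. C + (if b2 = b then A - C else 0) + (if b2 = b' then B - C else 0))"
    by (rule sum.cong) (use assms in auto)
  then show ?thesis by (simp add: sum.distrib algebra_simps)
qed

lemma sum_shift:
  fixes f :: "'a::{ab_group_add,finite} \<Rightarrow> complex"
  shows "(\<Sum>y\<in>UNIV. f (y - z)) = sum f UNIV" "(\<Sum>y\<in>UNIV. f (z - y)) = sum f UNIV"
proof -
  show "(\<Sum>y\<in>UNIV. f (y - z)) = sum f UNIV"
    by (rule sum.reindex_bij_witness[of _ "\<lambda>y. y + z" "\<lambda>y. y - z"]) auto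
  show "(\<Sum>y\<in>UNIV. f (z - y)) = sum f UNIV"
    by (rule sum.reindex_bij_witness[of _ "\<lambda>y. z - y" "\<lambda>y. z - y"]) auto
qed

lemma sum_affine:
  fixes f :: "'a::{field,finite} \<Rightarrow> complex"
  assumes "a \<noteq> 0"
  shows "(\<Sum>b\<in>UNIV. f (k + a * b)) = sum f UNIV"
  by (rule sum.reindex_bij_witness[of _ "\<lambda>y. (y - k) / a" "\<lambda>b. k + a * b"])
     (use assms in \<open>auto simp: field_simps\<close>)


text \<open>
  A triple \<open>(f, g, h)\<close> stands for \<open>\<Sum>\<^sub>\<gamma> f(\<gamma>) A\<^bsub>\<gamma>,0\<^esub> + \<Sum>\<^sub>\<gamma> g(\<gamma>) A\<^bsub>\<gamma>,1\<^esub> + h A\<^sub>2\<close>.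
\<close>

type_synonym 'a coef = "('a \<Rightarrow> complex) \<times> ('a \<Rightarrow> complex) \<times> complex"

text \<open>
  The multiplication table of the matrices in terms of coefficients:
  \<open>A\<^bsub>\<gamma>,0\<^esub> A\<^bsub>\<delta>,0\<^esub> = A\<^bsub>\<gamma>+\<delta>,0\<^esub>\<close>, \<open>A\<^bsub>\<gamma>,0\<^esub> A\<^bsub>\<delta>,1\<^esub> = A\<^bsub>\<gamma>+\<delta>,1\<^esub>\<close>, \<open>A\<^bsub>\<gamma>,1\<^esub> A\<^bsub>\<delta>,0\<^esub> = A\<^bsub>\<gamma>-\<delta>,1\<^esub>\<close>,
  \<open>A\<^bsub>\<gamma>,1\<^esub> A\<^bsub>\<delta>,1\<^esub> = q\<^sup>2 A\<^bsub>\<gamma>-\<delta>,0\<^esub> + q A\<^sub>2 + (q - 1) \<Sum>\<^sub>\<epsilon> A\<^bsub>\<epsilon>,1\<^esub>\<close>,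
  \<open>A\<^sub>2 A\<^bsub>\<gamma>,0\<^esub> = A\<^bsub>\<gamma>,0\<^esub> A\<^sub>2 = A\<^sub>2\<close>, \<open>A\<^sub>2 A\<^bsub>\<gamma>,1\<^esub> = A\<^bsub>\<gamma>,1\<^esub> A\<^sub>2 = (q - 1) \<Sum>\<^sub>\<epsilon> A\<^bsub>\<epsilon>,1\<^esub>\<close> and
  \<open>A\<^sub>2 A\<^sub>2 = q (q - 1) \<Sum>\<^sub>\<epsilon> A\<^bsub>\<epsilon>,0\<^esub> + q (q - 2) A\<^sub>2\<close>.
\<close>

fun coef_mult :: "'a::{field,finite} coef \<Rightarrow> 'a coef \<Rightarrow> 'a coef" where
  "coef_mult (f, g, h) (f', g', h') =
    (let q = of_nat CARD('a); F = sum f UNIV; F' = sum f' UNIV; G = sum g UNIV; G' = sum g' UNIV in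
     (\<lambda>d. (\<Sum>s\<in>UNIV. f s * f' (d - s)) + q^2 * (\<Sum>s\<in>UNIV. g s * g' (s - d)) + q * (q - 1) * h * h',
      \<lambda>d. (\<Sum>s\<in>UNIV. f s * g' (d - s)) + (\<Sum>s\<in>UNIV. g s * f' (s - d))
          + (q - 1) * (G * G' + h * G' + h' * G),
      h * F' + h' * F + q * G * G' + q * (q - 2) * h * h'))"

locale scheme_data = coordinates p m crd
  for p m :: nat and crd :: "'a::{field,finite} \<Rightarrow> nat list" +
  fixes L :: "'a option mat"
  assumes latin: "latin_square (CARD('a) + 1) L"
    and L_symmetric: "transpose_mat L = L"
    and L_diagonal: "\<And>i. i \<le> CARD('a) \<Longrightarrow> L $$ (i, i) = None"
begin

text \<open>
  The symbol at an off-diagonal position; on the diagonal the value is arbitrary.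
\<close>

definition symb :: "nat \<Rightarrow> nat \<Rightarrow> 'a" where
  "symb u w = the (L $$ (u, w))"

lemma L_carrier: "L \<in> carrier_mat (CARD('a) + 1) (CARD('a) + 1)"
  using latin by (simp add: latin_square_def)

lemma L_row: "u \<le> CARD('a) \<Longrightarrow> bij_betw (\<lambda>w. L $$ (u, w)) {..CARD('a)} UNIV"
  and L_column: "u \<le> CARD('a) \<Longrightarrow> bij_betw (\<lambda>w. L $$ (w, u)) {..CARD('a)} UNIV"
  using latin by (simp_all add: latin_square_def less_Suc_eq_le lessThan_Suc_atMost)

lemma L_None_iff:
  "u \<le> CARD('a) \<Longrightarrow> w \<le> CARD('a) \<Longrightarrow> L $$ (u, w) = None \<longleftrightarrow> u = w"
  using L_row[of u] L_diagonal[of u] unfolding bij_betw_def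
  by (metis atMost_iff inj_onD)

lemma L_symb:
  "u \<le> CARD('a) \<Longrightarrow> w \<le> CARD('a) \<Longrightarrow> u \<noteq> w \<Longrightarrow> L $$ (u, w) = Some (symb u w)"
  using L_None_iff[of u w] by (simp add: symb_def)

lemma symb_commute:
  assumes "u \<le> CARD('a)" "w \<le> CARD('a)"
  shows "symb u w = symb w u"
proof -
  have "L $$ (u, w) = transpose_mat L $$ (u, w)" by (simp add: L_symmetric)
  also have "\<dots> = L $$ (w, u)" using assms L_carrier by simp
  finally show ?thesis by (simp add: symb_def)
qed

lemma bij_symb:
  assumes u: "u \<le> CARD('a)"
  shows "bij_betw (symb u) ({..CARD('a)} - {u}) UNIV"
proof -
  have "bij_betw (\<lambda>w. L $$ (u, w)) ({..CARD('a)} - {u}) (UNIV - {None})"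
    using bij_betw_DiffI[OF L_row[OF u], of "{u}" "{None}"] u L_diagonal[OF u] by simp
  moreover have "bij_betw the (UNIV - {None}) (UNIV :: 'a set)"
    by (rule bij_betw_byWitness[of _ Some]) auto
  ultimately have "bij_betw (the \<circ> (\<lambda>w. L $$ (u, w))) ({..CARD('a)} - {u}) UNIV"
    by (rule bij_betw_trans)
  then show ?thesis by (simp add: comp_def symb_def[abs_def])
qed

text \<open>
  By symmetry \<open>symb w u'\<close> stands in row \<open>u'\<close> of the same column \<open>w\<close> as \<open>symb u w\<close>.
\<close>

lemma symb_column_neq:
  assumes "u \<le> CARD('a)" "u' \<le> CARD('a)" "w \<le> CARD('a)" "u \<noteq> u'" "w \<noteq> u" "w \<noteq> u'"
  shows "symb u w \<noteq> symb w u'"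
proof
  assume "symb u w = symb w u'"
  then have "L $$ (u, w) = L $$ (u', w)"
    using assms L_symb symb_commute by metis
  then show False
    using L_column[OF assms(3)] assms unfolding bij_betw_def by (metis atMost_iff inj_onD)
qed

text \<open>
  For a field element \<open>a\<close>, the constant that the reflection \<open>z \<mapsto> c - z\<close> of both column coordinates
  contributes to the relation between two groups with symbol \<open>a\<close>.
\<close>

definition line_const :: "'a \<Rightarrow> 'a" where
  "line_const a = (1 - a) * top_elem"

text \<open>
  The entry of \<open>\<Sum>\<^sub>\<gamma> f(\<gamma>) A\<^bsub>\<gamma>,0\<^esub> + \<Sum>\<^sub>\<gamma> g(\<gamma>) A\<^bsub>\<gamma>,1\<^esub> + h A\<^sub>2\<close> at a pair of vertices.
\<close>

fun kern :: "'a coef \<Rightarrow> nat \<times> 'a \<times> 'a \<Rightarrow> nat \<times> 'a \<times> 'a \<Rightarrow> complex" where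
  "kern (f, g, h) (u, b, y) (u', b', y') =
    (if u = u' then if b = b' then f (y' - y) else h
     else g (line_const (symb u u') + symb u u' * (b + b') - y - y'))"

text \<open>
  The next five lemmas sum over the middle vertices \<open>(w, b2, y2)\<close> of one group \<open>w\<close>, according to how \<open>w\<close>
  relates to the groups \<open>u\<close> and \<open>u'\<close> of the outer vertices. First \<open>u = w = u'\<close>: only the fibres of the two
  outer vertices behave differently from the others.
\<close>

lemma kern_product_same_group:
  fixes f f' :: "'a \<Rightarrow> complex" and b b' :: 'a
  shows "(\<Sum>b2\<in>UNIV. \<Sum>y2\<in>UNIV. (if b = b2 then f (y2 - y) else h) * (if b2 = b' then f' (y' - y2) else h'))
    = (if b = b' then (\<Sum>s\<in>UNIV. f s * f' (y' - y - s)) + of_nat CARD('a) * (of_nat CARD('a) - 1) * h * h'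
       else h * sum f' UNIV + h' * sum f UNIV + of_nat CARD('a) * (of_nat CARD('a) - 2) * h * h')"
proof (cases "b = b'")
  case True
  have "(\<Sum>y2\<in>UNIV. f (y2 - y) * f' (y' - y2)) = (\<Sum>s\<in>UNIV. f s * f' (y' - y - s))"
    by (rule sum.reindex_bij_witness[of _ "\<lambda>s. s + y" "\<lambda>y2. y2 - y"]) (auto simp: algebra_simps)
  then have inner: "(\<Sum>y2\<in>UNIV. (if b = b2 then f (y2 - y) else h) * (if b2 = b' then f' (y' - y2) else h'))
      = (if b2 = b then \<Sum>s\<in>UNIV. f s * f' (y' - y - s) else of_nat CARD('a) * h * h')" for b2
    using True by auto
  show ?thesis unfolding inner sum_single_exception using True by (simp add: algebra_simps)
next
  case False
  then have "(\<Sum>y2\<in>UNIV. (if b = b2 then f (y2 - y) else h) * (if b2 = b' then f' (y' - y2) else h'))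
      = (if b2 = b then sum f UNIV * h' else if b2 = b' then h * sum f' UNIV
         else of_nat CARD('a) * h * h')" for b2
    by (auto simp: sum_shift simp flip: sum_distrib_left sum_distrib_right)
  then show ?thesis using False by (simp add: sum_two_exceptions algebra_simps)
qed

text \<open>
  The case \<open>u = w \<noteq> u'\<close>. The fibre of the left vertex contributes a convolution, and each of the other
  fibres contributes \<open>h\<close> times the total sum of \<open>g'\<close>.
\<close>

lemma kern_product_left_group:
  fixes f g' :: "'a \<Rightarrow> complex"
  shows "(\<Sum>b2\<in>UNIV. \<Sum>y2\<in>UNIV. (if b = b2 then f (y2 - y) else h) * g' (k + a * (b2 + b') - y2 - y'))
    = (\<Sum>s\<in>UNIV. f s * g' (k + a * (b + b') - y - y' - s)) + (of_nat CARD('a) - 1) * (h * sum g' UNIV)"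
proof -
  have 1: "(\<Sum>y2\<in>UNIV. f (y2 - y) * g' (k + a * (b + b') - y2 - y'))
      = (\<Sum>s\<in>UNIV. f s * g' (k + a * (b + b') - y - y' - s))"
    by (rule sum.reindex_bij_witness[of _ "\<lambda>s. s + y" "\<lambda>y2. y2 - y"]) (auto simp: algebra_simps)
  have 2: "(\<Sum>y2\<in>UNIV. g' (x - y2 - y')) = sum g' UNIV" for x
    using sum_shift(2)[of g' "x - y'"] by (simp add: algebra_simps)
  have "(\<Sum>y2\<in>UNIV. (if b = b2 then f (y2 - y) else h) * g' (k + a * (b2 + b') - y2 - y'))
      = (if b2 = b then \<Sum>s\<in>UNIV. f s * g' (k + a * (b + b') - y - y' - s) else h * sum g' UNIV)" for b2
    using 1 2 by (auto simp flip: sum_distrib_left)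
  then show ?thesis by (simp add: sum_single_exception)
qed

text \<open>
  The case \<open>u \<noteq> w = u'\<close>. Here \<open>y2\<close> enters both factors with a minus sign, whence a correlation.
\<close>

lemma kern_product_right_group:
  fixes f' g :: "'a \<Rightarrow> complex"
  shows "(\<Sum>b2\<in>UNIV. \<Sum>y2\<in>UNIV. g (k + a * (b + b2) - y - y2) * (if b2 = b' then f' (y' - y2) else h'))
    = (\<Sum>s\<in>UNIV. g s * f' (s - (k + a * (b + b') - y - y'))) + (of_nat CARD('a) - 1) * (h' * sum g UNIV)"
proof -
  have 1: "(\<Sum>y2\<in>UNIV. g (k + a * (b + b') - y - y2) * f' (y' - y2))
      = (\<Sum>s\<in>UNIV. g s * f' (s - (k + a * (b + b') - y - y')))"
    by (rule sum.reindex_bij_witness[of _ "\<lambda>s. k + a * (b + b') - y - s" "\<lambda>y2. k + a * (b + b') - y - y2"])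
       (auto simp: algebra_simps)
  have "(\<Sum>y2\<in>UNIV. g (k + a * (b + b2) - y - y2) * (if b2 = b' then f' (y' - y2) else h'))
      = (if b2 = b' then \<Sum>s\<in>UNIV. g s * f' (s - (k + a * (b + b') - y - y')) else h' * sum g UNIV)" for b2
    using 1 sum_shift(2)[of g] by (auto simp: mult.commute simp flip: sum_distrib_left)
  then show ?thesis by (simp add: sum_single_exception)
qed

text \<open>
  The case \<open>u = u' \<noteq> w\<close>. By symmetry of the Latin square both steps carry the symbol \<open>a\<close>, so that \<open>b2\<close>
  drops out of the difference of the two arguments and each of the \<open>q\<close> fibres contributes the same.
\<close>

lemma kern_product_returning:
  fixes g g' :: "'a \<Rightarrow> complex"
  shows "(\<Sum>b2\<in>UNIV. \<Sum>y2\<in>UNIV. g (k + a * (b + b2) - y - y2) * g' (k + a * (b2 + b') - y2 - y'))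
    = of_nat CARD('a) * (\<Sum>s\<in>UNIV. g s * g' (s - (y' - y) + a * (b' - b)))"
proof -
  have "(\<Sum>y2\<in>UNIV. g (k + a * (b + b2) - y - y2) * g' (k + a * (b2 + b') - y2 - y'))
      = (\<Sum>s\<in>UNIV. g s * g' (s - (y' - y) + a * (b' - b)))" for b2
    by (rule sum.reindex_bij_witness[of _ "\<lambda>s. k + a * (b + b2) - y - s" "\<lambda>y2. k + a * (b + b2) - y - y2"])
       (auto simp: algebra_simps)
  then show ?thesis by simp
qed

text \<open>
  The case of three distinct groups. The two symbols differ, so for every value \<open>s\<close> of the first
  argument the second one takes each value once as \<open>b2\<close> varies.
\<close>

lemma kern_product_three_groups:
  fixes g g' :: "'a \<Rightarrow> complex"
  assumes "a \<noteq> a'"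
  shows "(\<Sum>b2\<in>UNIV. \<Sum>y2\<in>UNIV. g (k + a * (b + b2) - y - y2) * g' (k' + a' * (b2 + b') - y2 - y'))
    = sum g UNIV * sum g' UNIV"
proof -
  have "(\<Sum>y2\<in>UNIV. g (k + a * (b + b2) - y - y2) * g' (k' + a' * (b2 + b') - y2 - y'))
      = (\<Sum>s\<in>UNIV. g s * g' ((s + k' - k + a' * b' - a * b + y - y') + (a' - a) * b2))" for b2
    by (rule sum.reindex_bij_witness[of _ "\<lambda>s. k + a * (b + b2) - y - s" "\<lambda>y2. k + a * (b + b2) - y - y2"])
       (auto simp: algebra_simps)
  then have "(\<Sum>b2\<in>UNIV. \<Sum>y2\<in>UNIV. g (k + a * (b + b2) - y - y2) * g' (k' + a' * (b2 + b') - y2 - y'))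
      = (\<Sum>b2\<in>UNIV. \<Sum>s\<in>UNIV. g s * g' ((s + k' - k + a' * b' - a * b + y - y') + (a' - a) * b2))"
    by simp
  also have "\<dots> = (\<Sum>s\<in>UNIV. \<Sum>b2\<in>UNIV. g s * g' ((s + k' - k + a' * b' - a * b + y - y') + (a' - a) * b2))"
    by (rule sum.swap)
  also have "\<dots> = (\<Sum>s\<in>UNIV. g s * sum g' UNIV)"
    using assms by (simp add: sum_affine flip: sum_distrib_left)
  finally show ?thesis by (simp add: sum_distrib_right)
qed

lemma kern_product:
  assumes u: "u \<le> CARD('a)" and u': "u' \<le> CARD('a)"
  shows "(\<Sum>w\<le>CARD('a). \<Sum>b2\<in>UNIV. \<Sum>y2\<in>UNIV. kern X (u, b, y) (w, b2, y2) * kern X' (w, b2, y2) (u', b', y'))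
    = kern (coef_mult X X') (u, b, y) (u', b', y')" (is "?lhs = _")
proof -
  obtain f g h f' g' h' where X: "X = (f, g, h)" "X' = (f', g', h')" by (metis prod_cases3)
  let ?q = "of_nat CARD('a) :: complex"
  define P where "P w = (\<Sum>b2\<in>UNIV. \<Sum>y2\<in>UNIV.
    kern X (u, b, y) (w, b2, y2) * kern X' (w, b2, y2) (u', b', y'))" for w
  have lhs: "?lhs = sum P {..CARD('a)}"
    by (rule sum.cong) (simp_all only: P_def)
  show ?thesis
  proof (cases "u = u'")
    case True
    have Pu: "P u = (if b = b'
        then (\<Sum>s\<in>UNIV. f s * f' (y' - y - s)) + ?q * (?q - 1) * h * h'
        else h * sum f' UNIV + h' * sum f UNIV + ?q * (?q - 2) * h * h')"
      unfolding P_def X kern.simps using True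
      by (simp add: kern_product_same_group cong: if_cong)
    \<comment> \<open>As \<open>w\<close> runs through the other groups, the symbol runs once through the field, and the argument
      of \<open>g'\<close> is a bijective affine function of the symbol unless \<open>b = b'\<close>, when it is constant.\<close>
    have "P w = ?q * (\<Sum>s\<in>UNIV. g s * g' (s - (y' - y) + symb u w * (b' - b)))"
      if "w \<in> {..CARD('a)} - {u}" for w
      using that True u symb_commute[of w u] unfolding P_def X kern.simps
      by (simp add: kern_product_returning)
    then have "sum P ({..CARD('a)} - {u})
        = (\<Sum>w\<in>{..CARD('a)} - {u}. ?q * (\<Sum>s\<in>UNIV. g s * g' (s - (y' - y) + symb u w * (b' - b))))"
      by (rule sum.cong[OF refl])
    also have "\<dots> = (\<Sum>a\<in>UNIV. ?q * (\<Sum>s\<in>UNIV. g s * g' (s - (y' - y) + a * (b' - b))))"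
      by (rule sum.reindex_bij_betw[OF bij_symb[OF u]])
    also have "\<dots> = ?q * (\<Sum>s\<in>UNIV. \<Sum>a\<in>UNIV. g s * g' (s - (y' - y) + a * (b' - b)))"
      by (simp only: sum_distrib_left) (rule sum.swap)
    also have "\<dots> = (if b = b' then ?q^2 * (\<Sum>s\<in>UNIV. g s * g' (s - (y' - y)))
        else ?q * sum g UNIV * sum g' UNIV)"
    proof (cases "b = b'")
      case True
      then show ?thesis by (simp add: power2_eq_square sum_distrib_left mult.assoc)
    next
      case False
      then have "(\<Sum>a\<in>UNIV. g' (s - (y' - y) + a * (b' - b))) = sum g' UNIV" for s
        using sum_affine[of "b' - b" g' "s - (y' - y)"] by (simp add: mult.commute)
      with False show ?thesis
        by (simp add: mult.assoc flip: sum_distrib_left sum_distrib_right)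
    qed
    finally have rest: "sum P ({..CARD('a)} - {u}) = \<dots>" .
    have "sum P {..CARD('a)} = P u + sum P ({..CARD('a)} - {u})"
      by (rule sum.remove) (use u in auto)
    also have "\<dots> = kern (coef_mult X X') (u, b, y) (u', b', y')"
      unfolding Pu rest using True by (simp add: X Let_def)
    finally show ?thesis by (simp only: lhs)
  next
    case False
    define d where "d = line_const (symb u u') + symb u u' * (b + b') - y - y'"
    have Pu: "P u = (\<Sum>s\<in>UNIV. f s * g' (d - s)) + (?q - 1) * (h * sum g' UNIV)"
      unfolding P_def X kern.simps d_def using False
      by (simp add: kern_product_left_group cong: if_cong)
    have Pu': "P u' = (\<Sum>s\<in>UNIV. g s * f' (s - d)) + (?q - 1) * (h' * sum g UNIV)"
      unfolding P_def X kern.simps d_def using False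
      by (simp add: kern_product_right_group cong: if_cong)
    have "P w = sum g UNIV * sum g' UNIV" if "w \<in> {..CARD('a)} - {u} - {u'}" for w
      using that False kern_product_three_groups[OF symb_column_neq[OF u u' _ False, of w]]
      unfolding P_def X kern.simps by simp
    then have rest: "sum P ({..CARD('a)} - {u} - {u'}) = (?q - 1) * (sum g UNIV * sum g' UNIV)"
      using u u' False by (simp add: card_Diff_subset of_nat_diff Suc_le_eq)
    have "sum P {..CARD('a)} = P u + (P u' + sum P ({..CARD('a)} - {u} - {u'}))"
      using u u' False by (simp add: sum.remove[of _ u] sum.remove[of _ u'])
    also have "\<dots> = kern (coef_mult X X') (u, b, y) (u', b', y')"
      unfolding Pu Pu' rest using False by (simp add: X Let_def d_def algebra_simps)
    finally show ?thesis by (simp only: lhs)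
  qed
qed

text \<open>
  The vertex at a position, in the order in which the Kronecker products arrange the blocks.
\<close>

definition point :: "nat \<Rightarrow> nat \<times> 'a \<times> 'a" where
  "point n = (n div CARD('a)^2, lex_elem p crd (n div CARD('a) mod CARD('a)), lex_elem p crd (n mod CARD('a)))"

lemma bij_point: "bij_betw point {..<CARD('a)^2 * (CARD('a) + 1)} ({..CARD('a)} \<times> UNIV \<times> UNIV)"
proof -
  let ?q = "CARD('a)"
  have inj: "inj_on point {..<CARD('a)^2 * (CARD('a) + 1)}"
  proof (rule inj_onI)
    fix n n' assume eq: "point n = point n'"
    have lex: "k = k'" if "lex_elem p crd k = lex_elem p crd k'" "k < ?q" "k' < ?q" for k k'
      using that lex_pos_elem by metis
    have "n div ?q div ?q = n' div ?q div ?q"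
      using eq by (simp add: point_def power2_eq_square div_mult2_eq)
    moreover have "n div ?q mod ?q = n' div ?q mod ?q" "n mod ?q = n' mod ?q"
      using eq lex by (auto simp: point_def)
    ultimately show "n = n'" by (metis div_mult_mod_eq)
  qed
  have "point ` {..<CARD('a)^2 * (CARD('a) + 1)} \<subseteq> {..?q} \<times> UNIV \<times> UNIV"
  proof
    fix t assume "t \<in> point ` {..<CARD('a)^2 * (CARD('a) + 1)}"
    then obtain n where n: "n < ?q^2 * (?q + 1)" "t = point n" by auto
    then have "n div ?q^2 < ?q + 1"
      by (simp add: div_less_iff_less_mult mult.commute)
    then show "t \<in> {..?q} \<times> UNIV \<times> UNIV" using n by (simp add: point_def)
  qed
  moreover have "card (point ` {..<CARD('a)^2 * (CARD('a) + 1)}) = card ({..?q} \<times> (UNIV :: 'a set) \<times> (UNIV :: 'a set))"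
    using card_image[OF inj] by (simp add: card_cartesian_product power2_eq_square)
  ultimately have "point ` {..<CARD('a)^2 * (CARD('a) + 1)} = {..?q} \<times> UNIV \<times> UNIV"
    by (intro card_subset_eq) auto
  with inj show ?thesis by (simp add: bij_betw_def)
qed

lemma point_cases:
  assumes "i < CARD('a)^2 * (CARD('a) + 1)"
  obtains u b y where "point i = (u, b, y)" "u \<le> CARD('a)"
  using bij_betwE[OF bij_point] assms by (metis atMost_iff lessThan_iff mem_Sigma_iff prod_cases3)

lemma point_surj:
  assumes "u \<le> CARD('a)"
  obtains i where "i < CARD('a)^2 * (CARD('a) + 1)" "point i = (u, b, y)"
proof -
  have "(u, b, y) \<in> point ` {..<CARD('a)^2 * (CARD('a) + 1)}" using bij_point assms by (simp add: bij_betw_def)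
  then show thesis using that by auto
qed

definition coef_mat :: "'a coef \<Rightarrow> complex mat" where
  "coef_mat X = mat (CARD('a)^2 * (CARD('a) + 1)) (CARD('a)^2 * (CARD('a) + 1)) (\<lambda>(i, j). kern X (point i) (point j))"

lemma coef_mat_carrier [simp]: "coef_mat X \<in> carrier_mat (CARD('a)^2 * (CARD('a) + 1)) (CARD('a)^2 * (CARD('a) + 1))"
  by (simp add: coef_mat_def)

lemma coef_mat_mult: "coef_mat X * coef_mat X' = coef_mat (coef_mult X X')"
proof (rule eq_matI)
  fix i j assume "i < dim_row (coef_mat (coef_mult X X'))" "j < dim_col (coef_mat (coef_mult X X'))"
  then have ij: "i < CARD('a)^2 * (CARD('a) + 1)" "j < CARD('a)^2 * (CARD('a) + 1)" by (simp_all add: coef_mat_def)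
  obtain u b y u' b' y' where pt: "point i = (u, b, y)" "u \<le> CARD('a)"
      "point j = (u', b', y')" "u' \<le> CARD('a)"
    using point_cases[OF ij(1)] point_cases[OF ij(2)] by metis
  have "(coef_mat X * coef_mat X') $$ (i, j)
      = (\<Sum>k<CARD('a)^2 * (CARD('a) + 1). kern X (point i) (point k) * kern X' (point k) (point j))"
    using ij by (simp add: coef_mat_def scalar_prod_def atLeast0LessThan)
  also have "\<dots> = (\<Sum>t\<in>{..CARD('a)} \<times> UNIV \<times> UNIV. kern X (point i) t * kern X' t (point j))"
    by (rule sum.reindex_bij_betw[OF bij_point])
  also have "\<dots> = kern (coef_mult X X') (point i) (point j)"
    using kern_product[OF pt(2,4), of X b y X' b' y'] by (simp add: pt sum.cartesian_product case_prod_unfold)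
  finally show "(coef_mat X * coef_mat X') $$ (i, j) = coef_mat (coef_mult X X') $$ (i, j)"
    using ij by (simp add: coef_mat_def)
qed (simp_all add: coef_mat_def)

end


section \<open>Primitive idempotents of a split algebra\<close>

text \<open>
  The functionals \<open>ev k\<close> identify \<open>M ` T\<close> with an algebra of functions on \<open>K\<close> under pointwise
  operations, and \<open>e k\<close> with the indicator of \<open>k\<close>. Idempotents are then the functions with values 0 and 1, and the
  primitive ones among them are the indicators of points: any other nonzero idempotent splits off
  the indicator of a point at which it is 1.
\<close>

lemma primitive_idempotents_of_split_algebra:
  fixes M :: "'t \<Rightarrow> complex mat" and ev :: "'k \<Rightarrow> 't \<Rightarrow> complex"
  assumes mult: "\<And>x y. x \<in> T \<Longrightarrow> y \<in> T \<Longrightarrow>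
      \<exists>z\<in>T. M x * M y = M z \<and> (\<forall>k\<in>K. ev k z = ev k x * ev k y)"
    and add: "\<And>x y. x \<in> T \<Longrightarrow> y \<in> T \<Longrightarrow>
      \<exists>z\<in>T. M x + M y = M z \<and> (\<forall>k\<in>K. ev k z = ev k x + ev k y)"
    and diff: "\<And>x y. x \<in> T \<Longrightarrow> y \<in> T \<Longrightarrow> \<exists>z\<in>T. \<forall>k\<in>K. ev k z = ev k x - ev k y"
    and zero: "\<exists>z\<in>T. 0\<^sub>m v v = M z \<and> (\<forall>k\<in>K. ev k z = 0)"
    and inj: "\<And>x y. x \<in> T \<Longrightarrow> y \<in> T \<Longrightarrow> M x = M y \<longleftrightarrow> (\<forall>k\<in>K. ev k x = ev k y)"
    and e: "\<And>k. k \<in> K \<Longrightarrow> e k \<in> T"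
    and dual: "\<And>j k. j \<in> K \<Longrightarrow> k \<in> K \<Longrightarrow> ev j (e k) = of_bool (j = k)"
  shows "bij_betw (\<lambda>k. M (e k)) K {X. primitive_idempotent v (M ` T) X}"
proof -
  have mult_iff: "M x * M y = M z \<longleftrightarrow> (\<forall>k\<in>K. ev k z = ev k x * ev k y)"
    if "x \<in> T" "y \<in> T" "z \<in> T" for x y z
    using mult[OF that(1,2)] inj that(3) by (metis (no_types, lifting))
  have add_iff: "M z = M x + M y \<longleftrightarrow> (\<forall>k\<in>K. ev k z = ev k x + ev k y)"
    if "x \<in> T" "y \<in> T" "z \<in> T" for x y z
    using add[OF that(1,2)] inj that(3) by (metis (no_types, lifting))
  have zero_iff: "M x = 0\<^sub>m v v \<longleftrightarrow> (\<forall>k\<in>K. ev k x = 0)" if "x \<in> T" for x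
    using zero inj[OF that] by (metis (no_types, lifting))
  have mult_zero_iff: "M x * M y = 0\<^sub>m v v \<longleftrightarrow> (\<forall>k\<in>K. ev k x * ev k y = 0)"
    if "x \<in> T" "y \<in> T" for x y
    using mult[OF that] zero_iff by (metis (no_types, lifting))
  have idem_iff: "M x * M x = M x \<longleftrightarrow> (\<forall>k\<in>K. ev k x = 0 \<or> ev k x = 1)" if "x \<in> T" for x
    using mult_iff[OF that that that] by (metis mult_cancel_right1 mult_zero_left)
  have prim_e: "primitive_idempotent v (M ` T) (M (e k))" if k: "k \<in> K" for k
  proof -
    have False
      if x: "x \<in> T" and y: "y \<in> T" and nz: "M x \<noteq> 0\<^sub>m v v" "M y \<noteq> 0\<^sub>m v v"
        and idem: "M x * M x = M x" "M y * M y = M y" and sum: "M (e k) = M x + M y" for x y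
    proof -
      have ev_sum: "ev j x + ev j y = of_bool (j = k)" if "j \<in> K" for j
        using sum that add_iff[OF x y e[OF k]] dual[OF that k] by metis
      have "ev j x = 0 \<and> ev j y = 0" if "j \<in> K" "j \<noteq> k" for j
        using ev_sum[OF that(1)] that idem_iff[OF x] idem_iff[OF y] idem by fastforce
      moreover have "ev k x = 0 \<or> ev k y = 0"
        using ev_sum[OF k] k idem_iff[OF x] idem_iff[OF y] idem by fastforce
      ultimately show False using nz zero_iff[OF x] zero_iff[OF y] by metis
    qed
    moreover have "M (e k) \<noteq> 0\<^sub>m v v" using zero_iff[OF e[OF k]] dual[OF k k] k by force
    moreover have "M (e k) * M (e k) = M (e k)" using idem_iff[OF e[OF k]] dual[OF _ k] by simp
    ultimately show ?thesis unfolding primitive_idempotent_def using e[OF k] by blast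
  qed
  have "X \<in> (\<lambda>k. M (e k)) ` K" if X: "primitive_idempotent v (M ` T) X" for X
  proof -
    obtain x where x: "x \<in> T" "X = M x" "M x \<noteq> 0\<^sub>m v v" "M x * M x = M x"
      using X unfolding primitive_idempotent_def by blast
    have ev01: "ev j x = 0 \<or> ev j x = 1" if "j \<in> K" for j using idem_iff[OF x(1)] x(4) that by blast
    obtain k where k: "k \<in> K" "ev k x = 1" using ev01 zero_iff[OF x(1)] x(3) by blast
    obtain y where y: "y \<in> T" "\<And>j. j \<in> K \<Longrightarrow> ev j y = ev j x - ev j (e k)"
      using diff[OF x(1) e[OF k(1)]] by blast
    have ev_y: "ev j y = (if j = k then 0 else ev j x)" if "j \<in> K" for j
      using y(2)[OF that] dual[OF that k(1)] k by auto
    \<comment> \<open>If the remainder \<open>y\<close> were nonzero, then \<open>x = e k + y\<close> would be a forbidden decomposition.\<close>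
    have "M y * M y = M y" using idem_iff[OF y(1)] ev_y ev01 by simp
    moreover have "M (e k) * M y = 0\<^sub>m v v" "M y * M (e k) = 0\<^sub>m v v"
      using mult_zero_iff e[OF k(1)] y(1) ev_y dual[OF _ k(1)] by auto
    moreover have "M x = M (e k) + M y" using add_iff[OF e[OF k(1)] y(1) x(1)] y(2) by simp
    moreover have "M (e k) \<noteq> 0\<^sub>m v v" "M (e k) * M (e k) = M (e k)"
      using prim_e[OF k(1)] unfolding primitive_idempotent_def by auto
    ultimately have "M y = 0\<^sub>m v v"
      using X e[OF k(1)] y(1) unfolding primitive_idempotent_def x(2) by blast
    then have "M x = M (e k)" using inj[OF x(1) e[OF k(1)]] zero_iff[OF y(1)] y(2) by simp
    then show ?thesis using x(2) k(1) by blast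
  qed
  moreover have "inj_on (\<lambda>k. M (e k)) K"
  proof (rule inj_onI)
    fix j k assume jk: "j \<in> K" "k \<in> K" "M (e j) = M (e k)"
    then have "ev j (e j) = ev j (e k)" using inj[OF e[OF jk(1)] e[OF jk(2)]] by blast
    then show "j = k" using dual jk by simp
  qed
  ultimately show ?thesis using prim_e unfolding bij_betw_def by blast
qed

section \<open>The matrices of the scheme in terms of coefficients\<close>

context scheme_data
begin

lemma kern_lincomb:
  "(\<Sum>l\<in>I. c l * kern (K l) s t)
    = kern (\<lambda>x. \<Sum>l\<in>I. c l * fst (K l) x, \<lambda>x. \<Sum>l\<in>I. c l * fst (snd (K l)) x,
        \<Sum>l\<in>I. c l * snd (snd (K l))) s t"
proof -
  obtain u b y u' b' y' where st: "s = (u, b, y)" "t = (u', b', y')" by (metis prod_cases3)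
  have "kern (K l) s t = (if u = u' then if b = b' then fst (K l) (y' - y) else snd (snd (K l))
     else fst (snd (K l)) (line_const (symb u u') + symb u u' * (b + b') - y - y'))" for l
    by (cases "K l") (auto simp: st)
  then show ?thesis by (simp add: st)
qed

lemma kern_symmetric:
  assumes "u \<le> CARD('a)" "u' \<le> CARD('a)" "\<And>x. f (- x) = f x"
  shows "kern (f, g, h) (u, b, y) (u', b', y') = kern (f, g, h) (u', b', y') (u, b, y)"
  using assms(3)[of "y' - y"] symb_commute[OF assms(1,2)] by (simp add: algebra_simps)

lemma coef_mat_inj: "coef_mat X = coef_mat X' \<Longrightarrow> X = X'"
proof -
  assume eq: "coef_mat X = coef_mat X'"
  obtain f g h f' g' h' where X: "X = (f, g, h)" "X' = (f', g', h')" by (metis prod_cases3)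
  have kern_eq: "kern X (u, b, y) (u', b', y') = kern X' (u, b, y) (u', b', y')"
    if u: "u \<le> CARD('a)" "u' \<le> CARD('a)" for u b y u' b' y'
  proof -
    obtain i j where "i < CARD('a)^2 * (CARD('a) + 1)" "point i = (u, b, y)"
        "j < CARD('a)^2 * (CARD('a) + 1)" "point j = (u', b', y')"
      using point_surj u by metis
    then show ?thesis using arg_cong[OF eq, of "\<lambda>A. A $$ (i, j)"] by (simp add: coef_mat_def)
  qed
  \<comment> \<open>Each coefficient occurs as an entry in the row of the vertex \<open>(0, 0, 0)\<close>.\<close>
  have "f x = f' x" for x using kern_eq[of 0 0 0 0 0 x] by (simp add: X)
  moreover have "g x = g' x" for x
    using kern_eq[of 0 1 0 0 0 "line_const (symb 0 1) - x"] by (simp add: X)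
  moreover have "h = h'" using kern_eq[of 0 0 0 0 1 0] by (simp add: X)
  ultimately show ?thesis by (auto simp: X)
qed

lemma coef_mat_zero: "0\<^sub>m (CARD('a)^2 * (CARD('a) + 1)) (CARD('a)^2 * (CARD('a) + 1)) = coef_mat (\<lambda>_. 0, \<lambda>_. 0, 0)"
proof -
  have "kern (\<lambda>_. 0, \<lambda>_. 0, 0) s t = 0" for s t
    by (cases s; cases t) auto
  then show ?thesis by (intro eq_matI) (auto simp: coef_mat_def)
qed

lemma coef_mat_add:
  "coef_mat (f, g, h) + coef_mat (f', g', h') = coef_mat (\<lambda>x. f x + f' x, \<lambda>x. g x + g' x, h + h')"
proof -
  have "kern (f, g, h) s t + kern (f', g', h') s t = kern (\<lambda>x. f x + f' x, \<lambda>x. g x + g' x, h + h') s t" for s t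
    by (cases s; cases t) auto
  then show ?thesis by (intro eq_matI) (auto simp: coef_mat_def)
qed

lemma coef_mat_smult:
  "c \<cdot>\<^sub>m coef_mat (f, g, h) = coef_mat (\<lambda>x. c * f x, \<lambda>x. c * g x, c * h)"
proof -
  have "c * kern (f, g, h) s t = kern (\<lambda>x. c * f x, \<lambda>x. c * g x, c * h) s t" for s t
    by (cases s; cases t) auto
  then show ?thesis by (intro eq_matI) (auto simp: coef_mat_def)
qed


text \<open>
  The same digits, read off within a block of order \<open>q\<^sup>2\<close>.
\<close>

lemma point_eq:
  "point n = (n div CARD('a)^2, lex_elem p crd (n mod CARD('a)^2 div CARD('a)),
    lex_elem p crd (n mod CARD('a)^2 mod CARD('a)))"
proof -
  have "n mod CARD('a)^2 = CARD('a) * (n div CARD('a) mod CARD('a)) + n mod CARD('a)"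
    by (simp add: power2_eq_square mod_mult2_eq)
  then show ?thesis by (simp add: point_def)
qed

lemma lex_elem_eq_iff:
  "i < CARD('a) \<Longrightarrow> j < CARD('a) \<Longrightarrow> lex_elem p crd i = lex_elem p crd j \<longleftrightarrow> i = j"
  by (metis lex_pos_elem)

lemma A0_carrier: "A0 p crd \<alpha> \<in> carrier_mat (CARD('a)^2 * (CARD('a) + 1)) (CARD('a)^2 * (CARD('a) + 1))"
proof -
  have "CARD('a) * (CARD('a) + 1) * CARD('a) = CARD('a)^2 * (CARD('a) + 1)"
    by (simp only: power2_eq_square mult_ac)
  then show ?thesis
    using kron_carrier[OF one_carrier_mat phi_carrier, of "CARD('a) * (CARD('a) + 1)" \<alpha>]
    by (simp only: A0_def Let_def)
qed

lemma A0_eq_coef_mat: "A0 p crd \<alpha> = coef_mat (\<lambda>x. of_bool (x = \<alpha>), \<lambda>_. 0, 0)"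
proof (rule eq_matI)
  let ?q = "CARD('a)"
  fix i j assume "i < dim_row (coef_mat (\<lambda>x. of_bool (x = \<alpha>), \<lambda>_. 0, 0))"
    "j < dim_col (coef_mat (\<lambda>x. of_bool (x = \<alpha>), \<lambda>_. 0, 0))"
  then have ij: "i < ?q^2 * (?q + 1)" "j < ?q^2 * (?q + 1)" by (simp_all add: coef_mat_def)
  have bound: "n div ?q < ?q * (?q + 1)" if "n < ?q^2 * (?q + 1)" for n
    using that by (simp add: div_less_iff_less_mult power2_eq_square algebra_simps)
  have block: "i div ?q = j div ?q \<longleftrightarrow> i div ?q^2 = j div ?q^2
      \<and> lex_elem p crd (i div ?q mod ?q) = lex_elem p crd (j div ?q mod ?q)"
    by (subst lex_elem_eq_iff, simp, simp, simp only: power2_eq_square div_mult2_eq) (metis div_mult_mod_eq)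
  have "i < ?q * (?q + 1) * ?q" "j < ?q * (?q + 1) * ?q"
    using ij by (simp_all only: power2_eq_square mult_ac)
  then have "A0 p crd \<alpha> $$ (i, j) = of_bool (i div ?q = j div ?q) * phi p crd \<alpha> $$ (i mod ?q, j mod ?q)"
    using bound[OF ij(1)] bound[OF ij(2)] kron_index[OF one_carrier_mat phi_carrier]
    by (simp add: A0_def Let_def)
  also have "\<dots> = of_bool (i div ?q = j div ?q \<and> lex_elem p crd (j mod ?q) = lex_elem p crd (i mod ?q) + \<alpha>)"
    by (simp add: phi_entry_elem)
  also have "\<dots> = coef_mat (\<lambda>x. of_bool (x = \<alpha>), \<lambda>_. 0, 0) $$ (i, j)"
    using ij by (auto simp: coef_mat_def point_def block algebra_simps)
  finally show "A0 p crd \<alpha> $$ (i, j) = coef_mat (\<lambda>x. of_bool (x = \<alpha>), \<lambda>_. 0, 0) $$ (i, j)" .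
qed (simp_all only: carrier_matD[OF A0_carrier] carrier_matD[OF coef_mat_carrier])

lemma A2_block_carrier:
  "all_ones (CARD('a)^2) - 1\<^sub>m CARD('a) \<otimes>\<^sub>m all_ones CARD('a) \<in> carrier_mat (CARD('a)^2) (CARD('a)^2)"
  by (auto simp: all_ones_def kron_def power2_eq_square)

lemma A2_carrier: "A2 TYPE('a) \<in> carrier_mat (CARD('a)^2 * (CARD('a) + 1)) (CARD('a)^2 * (CARD('a) + 1))"
  using kron_carrier[OF one_carrier_mat A2_block_carrier, of "CARD('a) + 1"]
  by (simp only: A2_def Let_def mult.commute)

lemma A2_eq_coef_mat: "A2 TYPE('a) = coef_mat (\<lambda>_. 0, \<lambda>_. 0, 1)"
proof (rule eq_matI)
  let ?q = "CARD('a)"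
  fix i j assume "i < dim_row (coef_mat (\<lambda>_. 0, \<lambda>_. 0, 1))" "j < dim_col (coef_mat (\<lambda>_. 0, \<lambda>_. 0, 1))"
  then have ij: "i < ?q^2 * (?q + 1)" "j < ?q^2 * (?q + 1)" by (simp_all add: coef_mat_def)
  have bound: "n div ?q^2 < ?q + 1" if "n < ?q^2 * (?q + 1)" for n
    using that by (simp add: div_less_iff_less_mult mult.commute)
  have bound2: "n mod ?q^2 div ?q < ?q" for n
    by (intro less_mult_imp_div_less) (simp add: power2_eq_square)
  let ?D = "all_ones (?q^2) - 1\<^sub>m ?q \<otimes>\<^sub>m all_ones ?q"
  have D: "?D $$ (k, l) = 1 - of_bool (k div ?q = l div ?q)" if "k < ?q^2" "l < ?q^2" for k l
  proof -
    have "k div ?q < ?q" "l div ?q < ?q"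
      using that by (auto intro!: less_mult_imp_div_less simp: power2_eq_square)
    moreover have "all_ones ?q \<in> carrier_mat ?q ?q" by (simp add: all_ones_def)
    ultimately show ?thesis
      using that kron_index[OF one_carrier_mat, of "all_ones ?q" ?q ?q k ?q l]
      by (simp add: all_ones_def power2_eq_square) (simp add: kron_def)
  qed
  have "i < (?q + 1) * ?q^2" "j < (?q + 1) * ?q^2"
    using ij by (simp_all only: mult.commute)
  then have "A2 TYPE('a) $$ (i, j) = of_bool (i div ?q^2 = j div ?q^2)
      * (1 - of_bool (i mod ?q^2 div ?q = j mod ?q^2 div ?q))"
    using bound[OF ij(1)] bound[OF ij(2)] kron_index[OF one_carrier_mat A2_block_carrier]
    by (simp add: A2_def Let_def D)
  also have "\<dots> = coef_mat (\<lambda>_. 0, \<lambda>_. 0, 1) $$ (i, j)"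
    using ij bound2 by (simp add: coef_mat_def point_eq lex_elem_eq_iff)
  finally show "A2 TYPE('a) $$ (i, j) = coef_mat (\<lambda>_. 0, \<lambda>_. 0, 1) $$ (i, j)" .
qed (simp_all only: carrier_matD[OF A2_carrier] carrier_matD[OF coef_mat_carrier])

text \<open>
  The back identity reflects both column coordinates. Since \<open>C\<^bsub>a,\<alpha>\<^esub>\<close> has the entry 1 at
  \<open>((b, y), (b', y'))\<close> iff \<open>y' = y + a (b' - b) + \<alpha>\<close>, the product has it iff
  \<open>c - y' = y + a (c - b' - b) + \<alpha>\<close>, which is symmetric in the two vertices.
\<close>

lemma Cmat_back_identity_entry:
  assumes "k < CARD('a)^2" "l < CARD('a)^2"
  shows "(Cmat p crd a \<alpha> * back_identity (CARD('a)^2)) $$ (k, l) = of_bool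
    (line_const a + a * (lex_elem p crd (k div CARD('a)) + lex_elem p crd (l div CARD('a)))
      - lex_elem p crd (k mod CARD('a)) - lex_elem p crd (l mod CARD('a)) = \<alpha>)"
proof -
  let ?q = "CARD('a)"
  let ?l = "?q^2 - 1 - l"
  have lq: "l div ?q < ?q" "k div ?q < ?q"
    using assms by (simp_all add: div_less_iff_less_mult power2_eq_square)
  have lm: "l mod ?q < ?q" by simp
  \<comment> \<open>Column \<open>l\<close> of the product is column \<open>q\<^sup>2 - 1 - l\<close> of the first factor, whose digits are the complements.\<close>
  have split: "?l = (?q - 1 - l div ?q) * ?q + (?q - 1 - l mod ?q)"
  proof -
    have "l div ?q * ?q + l mod ?q = l" by simp
    moreover have "(?q - 1 - l div ?q) * ?q + l div ?q * ?q = (?q - 1) * ?q"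
      using lq(1) by (simp flip: add_mult_distrib)
    moreover have "(?q - 1) * ?q + ?q = ?q^2"
      by (simp add: power2_eq_square algebra_simps)
    moreover have "l mod ?q < ?q" by simp
    ultimately show ?thesis by linarith
  qed
  have div: "?l div ?q = ?q - 1 - l div ?q" and mod: "?l mod ?q = ?q - 1 - l mod ?q"
    unfolding split by simp_all
  have "(Cmat p crd a \<alpha> * back_identity (?q^2)) $$ (k, l)
      = (\<Sum>t<?q^2. Cmat p crd a \<alpha> $$ (k, t) * back_identity (?q^2) $$ (t, l))"
    using assms by (simp add: Cmat_def back_identity_def scalar_prod_def atLeast0LessThan Let_def)
  also have "\<dots> = (\<Sum>t<?q^2. if t = ?l then Cmat p crd a \<alpha> $$ (k, t) else 0)"
    using assms by (intro sum.cong) (auto simp: back_identity_def)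
  also have "\<dots> = Cmat p crd a \<alpha> $$ (k, ?l)"
    using assms by simp
  also have "\<dots> = phi p crd (a * (- lex_elem p crd (k div ?q) + lex_elem p crd (?l div ?q)) + \<alpha>)
      $$ (k mod ?q, ?l mod ?q)"
    using assms by (simp add: Cmat_def Let_def)
  also have "\<dots> = of_bool (lex_elem p crd (?l mod ?q) = lex_elem p crd (k mod ?q)
      + (a * (- lex_elem p crd (k div ?q) + lex_elem p crd (?l div ?q)) + \<alpha>))"
    by (simp add: phi_entry_elem)
  also have "\<dots> = of_bool (line_const a + a * (lex_elem p crd (k div ?q) + lex_elem p crd (l div ?q))
      - lex_elem p crd (k mod ?q) - lex_elem p crd (l mod ?q) = \<alpha>)"
    unfolding div mod lex_elem_complement[OF lq(1)] lex_elem_complement[OF lm]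
    by (auto simp: line_const_def algebra_simps)
  finally show ?thesis .
qed

lemma A1_eq_coef_mat: "A1 p crd L \<alpha> = coef_mat (\<lambda>_. 0, \<lambda>x. of_bool (x = \<alpha>), 0)"
proof -
  let ?q = "CARD('a)"
  let ?v = "?q^2 * (?q + 1)"
  let ?B = "\<lambda>a. symbol_mat L (Some a) \<otimes>\<^sub>m (Cmat p crd a \<alpha> * back_identity (?q^2))"
  let ?X = "mat_lincomb ?v UNIV (\<lambda>_. 1) ?B"
  have "A2 TYPE('a) \<in> carrier_mat ?v ?v" by (simp only: A2_eq_coef_mat coef_mat_carrier)
  then have "A1 p crd L \<alpha> = ?X"
    unfolding A1_def Nmat_def Let_def by (intro eq_matI) (auto simp: mat_lincomb_def)
  also have "\<dots> = coef_mat (\<lambda>_. 0, \<lambda>x. of_bool (x = \<alpha>), 0)"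
  proof (rule eq_matI)
    fix i j assume "i < dim_row (coef_mat (\<lambda>_. 0, \<lambda>x. of_bool (x = \<alpha>), 0))"
      "j < dim_col (coef_mat (\<lambda>_. 0, \<lambda>x. of_bool (x = \<alpha>), 0))"
    then have ij: "i < ?v" "j < ?v" by (simp_all add: coef_mat_def)
    have bound: "n div ?q^2 < ?q + 1" if "n < ?v" for n
      using that by (simp add: div_less_iff_less_mult mult.commute)
    obtain u b y u' b' y' where pt: "point i = (u, b, y)" "u \<le> ?q" "point j = (u', b', y')" "u' \<le> ?q"
      using point_cases[OF ij(1)] point_cases[OF ij(2)] by metis
    have "?B a $$ (i, j) = (if L $$ (u, u') = Some a then
        of_bool (line_const a + a * (b + b') - y - y' = \<alpha>) else 0)" for a
    proof -
      have "?B a $$ (i, j) = (if L $$ (i div ?q^2, j div ?q^2) = Some a then 1 else 0) *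
        (Cmat p crd a \<alpha> * back_identity (?q^2)) $$ (i mod ?q^2, j mod ?q^2)"
      proof (subst kron_index)
        show "symbol_mat L (Some a) \<in> carrier_mat (?q + 1) (?q + 1)"
          using L_carrier by (simp add: symbol_mat_def)
        show "Cmat p crd a \<alpha> * back_identity (?q^2) \<in> carrier_mat (?q^2) (?q^2)"
          by (rule mult_carrier_mat[of _ _ "?q^2"]) (simp_all add: Cmat_def back_identity_def Let_def)
        show "i < (?q + 1) * ?q^2" "j < (?q + 1) * ?q^2"
          using ij by (simp_all only: mult.commute)
      qed (use bound[OF ij(1)] bound[OF ij(2)] L_carrier in \<open>simp add: symbol_mat_def\<close>)
      then show ?thesis using pt by (simp add: Cmat_back_identity_entry point_eq)
    qed
    then have "?X $$ (i, j) = (\<Sum>a\<in>UNIV. if L $$ (u, u') = Some a then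
        of_bool (line_const a + a * (b + b') - y - y' = \<alpha>) else 0)"
      using ij by (simp add: mat_lincomb_def)
    also have "\<dots> = kern (\<lambda>_. 0, \<lambda>x. of_bool (x = \<alpha>), 0) (u, b, y) (u', b', y')"
      using L_diagonal[OF pt(2)] L_symb[OF pt(2,4)] by (cases "u = u'") (simp_all add: sum.delta')
    finally show "?X $$ (i, j) = coef_mat (\<lambda>_. 0, \<lambda>x. of_bool (x = \<alpha>), 0) $$ (i, j)"
      using ij by (simp add: coef_mat_def pt)
  qed (auto simp: mat_lincomb_def coef_mat_def)
  finally show ?thesis .
qed

end


section \<open>The Fourier transform on the field\<close>

definition (in coordinates) fourier :: "'a \<Rightarrow> ('a \<Rightarrow> complex) \<Rightarrow> complex" where
  "fourier \<alpha> f = (\<Sum>\<gamma>\<in>UNIV. f \<gamma> * \<chi> \<alpha> \<gamma>)"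

context coordinates
begin

lemma fourier_0: "fourier 0 f = sum f UNIV"
  by (simp add: fourier_def)

lemma fourier_add: "fourier \<alpha> (\<lambda>x. f x + g x) = fourier \<alpha> f + fourier \<alpha> g"
  by (simp add: fourier_def algebra_simps sum.distrib)

lemma fourier_smult: "fourier \<alpha> (\<lambda>x. c * f x) = c * fourier \<alpha> f"
  by (simp add: fourier_def algebra_simps sum_distrib_left)

lemma fourier_const: "fourier \<alpha> (\<lambda>_. c) = (if \<alpha> = 0 then of_nat CARD('a) * c else 0)"
  using sum_chi[of \<alpha>] by (simp add: fourier_def flip: sum_distrib_left)

text \<open>
  An even function does not distinguish a character from its inverse, so both give the same Fourier
  coefficient.
\<close>

lemma fourier_uminus:
  assumes "\<And>x. f (- x) = f x"
  shows "fourier (- \<alpha>) f = fourier \<alpha> f"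
  unfolding fourier_def
  by (rule sum.reindex_bij_witness[of _ uminus uminus]) (auto simp: assms chi_minus_left)

lemma fourier_convolution:
  "fourier \<alpha> (\<lambda>d. \<Sum>s\<in>UNIV. f s * f' (d - s)) = fourier \<alpha> f * fourier \<alpha> f'"
proof -
  have "fourier \<alpha> (\<lambda>d. \<Sum>s\<in>UNIV. f s * f' (d - s))
      = (\<Sum>s\<in>UNIV. \<Sum>d\<in>UNIV. f s * f' (d - s) * \<chi> \<alpha> d)"
    unfolding fourier_def sum_distrib_right by (rule sum.swap)
  also have "\<dots> = (\<Sum>s\<in>UNIV. \<Sum>t\<in>UNIV. (f s * \<chi> \<alpha> s) * (f' t * \<chi> \<alpha> t))"
  proof (rule sum.cong[OF refl])
    fix s
    show "(\<Sum>d\<in>UNIV. f s * f' (d - s) * \<chi> \<alpha> d) = (\<Sum>t\<in>UNIV. (f s * \<chi> \<alpha> s) * (f' t * \<chi> \<alpha> t))"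
    proof (rule sum.reindex_bij_witness[of _ "\<lambda>t. t + s" "\<lambda>d. d - s"])
      fix d
      show "(f s * \<chi> \<alpha> s) * (f' (d - s) * \<chi> \<alpha> (d - s)) = f s * f' (d - s) * \<chi> \<alpha> d"
        using chi_add[of \<alpha> s "d - s"] by simp
    qed simp_all
  qed
  finally show ?thesis by (simp add: fourier_def sum_product)
qed

lemma fourier_correlation:
  "fourier \<alpha> (\<lambda>d. \<Sum>s\<in>UNIV. f s * f' (s - d)) = fourier \<alpha> f * fourier (- \<alpha>) f'"
proof -
  have "fourier \<alpha> (\<lambda>d. \<Sum>s\<in>UNIV. f s * f' (s - d))
      = fourier \<alpha> (\<lambda>d. \<Sum>s\<in>UNIV. f s * (\<lambda>t. f' (- t)) (d - s))"
    by simp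
  also have "\<dots> = fourier \<alpha> f * fourier \<alpha> (\<lambda>t. f' (- t))"
    by (rule fourier_convolution)
  also have "fourier \<alpha> (\<lambda>t. f' (- t)) = fourier (- \<alpha>) f'"
    unfolding fourier_def
    by (rule sum.reindex_bij_witness[of _ uminus uminus]) (auto simp: chi_minus_left)
  finally show ?thesis .
qed

lemma fourier_inversion:
  "(\<Sum>\<beta>\<in>UNIV. fourier \<beta> f * \<chi> \<beta> (- x)) = of_nat CARD('a) * f x"
proof -
  have "(\<Sum>\<beta>\<in>UNIV. fourier \<beta> f * \<chi> \<beta> (- x)) = (\<Sum>\<gamma>\<in>UNIV. \<Sum>\<beta>\<in>UNIV. f \<gamma> * \<chi> \<beta> \<gamma> * \<chi> \<beta> (- x))"
    unfolding fourier_def sum_distrib_right by (rule sum.swap)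
  also have "\<dots> = (\<Sum>\<gamma>\<in>UNIV. f \<gamma> * (\<Sum>\<beta>\<in>UNIV. \<chi> (\<gamma> - x) \<beta>))"
    by (intro sum.cong refl)
       (simp add: sum_distrib_left mult.assoc chi_commute[of "_ - x"] flip: chi_add)
  also have "\<dots> = (\<Sum>\<gamma>\<in>UNIV. if \<gamma> = x then f x * of_nat CARD('a) else 0)"
    by (intro sum.cong refl) (simp add: sum_chi)
  finally show ?thesis by simp
qed

lemma fourier_inj: "(\<And>\<alpha>. fourier \<alpha> f = fourier \<alpha> f') \<Longrightarrow> f = f'"
  using fourier_inversion[of f] fourier_inversion[of f'] by (intro ext) auto

lemma fourier_chi: "fourier \<beta> (\<chi> \<alpha>) = (if \<beta> = - \<alpha> then of_nat CARD('a) else 0)"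
  using sum_chi[of "\<alpha> + \<beta>"] by (auto simp: fourier_def chi_add_left add_eq_0_iff minus_equation_iff)

end

section \<open>Even coefficients and the functionals that diagonalise them\<close>

definition even_coefs :: "'a::{field,finite} coef set" where
  "even_coefs = {(f, g, h). (\<forall>x. f (- x) = f x) \<and> (\<forall>x. g (- x) = g x)}"

fun class_coef :: "'a::{field,finite} cls \<Rightarrow> 'a coef" where
  "class_coef (Cls0 \<alpha>) = (\<lambda>x. of_bool (x = \<alpha> \<or> x = - \<alpha>), \<lambda>_. 0, 0)"
| "class_coef (Cls1 \<alpha>) = (\<lambda>_. 0, \<lambda>x. of_bool (x = \<alpha> \<or> x = - \<alpha>), 0)"
| "class_coef Cls2 = (\<lambda>_. 0, \<lambda>_. 0, 1)"

locale symmetrized_scheme = scheme_data p m crd L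
  for p m :: nat and crd :: "'a::{field,finite} \<Rightarrow> nat list" and L :: "'a option mat" +
  fixes S :: "'a set"
  assumes S_Un: "S \<union> uminus ` S = UNIV - {0}" and S_Int: "S \<inter> uminus ` S = {}"
begin

lemma zero_notin_S: "0 \<notin> S"
  using S_Un by blast

text \<open>
  In particular no \<open>x \<in> S\<close> equals \<open>- x\<close>.
\<close>

lemma uminus_S: "x \<in> S \<Longrightarrow> - x \<notin> S"
  using S_Int by force

lemma S_cases: "x \<in> insert 0 S \<or> - x \<in> S"
  using S_Un by (cases "x = 0") force+

text \<open>
  The eigenvalue of \<open>coef_mat (f, g, h)\<close> on the idempotent of each column. The first is the row sum.
  \<open>Col1\<close> belongs to the vectors that are constant on fibres and sum to zero on every group, \<open>Col2\<close> to
  those that are constant on groups and sum to zero. On the part belonging to the character \<open>\<chi>\<^sub>\<alpha>\<close>, the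
  square of \<open>\<Sum>\<^sub>\<gamma> g(\<gamma>) A\<^bsub>\<gamma>,1\<^esub>\<close> is \<open>q\<^sup>2\<close> times the square of the Fourier coefficient of \<open>g\<close> at \<open>\<alpha>\<close>, and the
  two square roots give \<open>ColPlus \<alpha>\<close> and \<open>ColMinus \<alpha>\<close>.
\<close>

fun ev :: "'a col \<Rightarrow> 'a coef \<Rightarrow> complex" where
  "ev Col0 (f, g, h) = fourier 0 f + of_nat CARD('a)^2 * fourier 0 g
     + of_nat CARD('a) * (of_nat CARD('a) - 1) * h"
| "ev Col1 (f, g, h) = fourier 0 f - of_nat CARD('a) * h"
| "ev Col2 (f, g, h) = fourier 0 f - of_nat CARD('a) * fourier 0 g
     + of_nat CARD('a) * (of_nat CARD('a) - 1) * h"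
| "ev (ColPlus \<alpha>) (f, g, h) = fourier \<alpha> f + of_nat CARD('a) * fourier \<alpha> g"
| "ev (ColMinus \<alpha>) (f, g, h) = fourier \<alpha> f - of_nat CARD('a) * fourier \<alpha> g"

lemma coef_mult_even:
  fixes X X' :: "'a coef"
  assumes "X \<in> even_coefs" "X' \<in> even_coefs"
  shows "coef_mult X X' \<in> even_coefs"
proof -
  obtain f g h f' g' h' where X: "X = (f, g, h)" "X' = (f', g', h')" by (metis prod_cases3)
  have ev: "f (- x) = f x" "g (- x) = g x" "f' (- x) = f' x" "g' (- x) = g' x" for x
    using assms by (auto simp: X even_coefs_def)
  have conv: "(\<Sum>s\<in>UNIV. \<phi> s * \<psi> (- d - s)) = (\<Sum>s\<in>UNIV. \<phi> s * \<psi> (d - s))"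
    and corr: "(\<Sum>s\<in>UNIV. \<phi> s * \<psi> (s - - d)) = (\<Sum>s\<in>UNIV. \<phi> s * \<psi> (s - d))"
    if "\<And>x. \<phi> (- x) = \<phi> x" "\<And>x. \<psi> (- x) = \<psi> x" for \<phi> \<psi> :: "'a \<Rightarrow> complex" and d
  proof -
    show "(\<Sum>s\<in>UNIV. \<phi> s * \<psi> (- d - s)) = (\<Sum>s\<in>UNIV. \<phi> s * \<psi> (d - s))"
      using that(2)[of "d + _"]
      by (intro sum.reindex_bij_witness[of _ uminus uminus]) (auto simp: that(1) minus_diff_commute)
    show "(\<Sum>s\<in>UNIV. \<phi> s * \<psi> (s - - d)) = (\<Sum>s\<in>UNIV. \<phi> s * \<psi> (s - d))"
      using that(2)[of "_ + d"]
      by (intro sum.reindex_bij_witness[of _ uminus uminus]) (auto simp: that(1) algebra_simps)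
  qed
  show ?thesis
    using conv[of f f'] corr[of g g'] conv[of f g'] corr[of g f'] ev
    by (simp add: X even_coefs_def Let_def)
qed

text \<open>
  The Fourier transform turns the convolutions and correlations of \<open>coef_mult\<close> into products, where
  evenness removes the sign of the character in the correlations. The terms that are constant in
  \<open>d\<close> are only seen by the trivial character. What remains is a polynomial identity.
\<close>

lemma ev_mult:
  assumes "X \<in> even_coefs" "X' \<in> even_coefs" "k \<in> columns S"
  shows "ev k (coef_mult X X') = ev k X * ev k X'"
proof -
  obtain f g h f' g' h' where X: "X = (f, g, h)" "X' = (f', g', h')" by (metis prod_cases3)
  let ?q = "of_nat CARD('a) :: complex"
  have even: "fourier (- \<alpha>) f' = fourier \<alpha> f'" "fourier (- \<alpha>) g' = fourier \<alpha> g'" for \<alpha>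
    using assms(2) fourier_uminus[of f'] fourier_uminus[of g'] by (auto simp: X even_coefs_def)
  obtain f2 g2 h2 where Y: "coef_mult X X' = (f2, g2, h2)" by (metis prod_cases3)
  have f2: "fourier \<alpha> f2 = fourier \<alpha> f * fourier \<alpha> f' + ?q^2 * (fourier \<alpha> g * fourier \<alpha> g')
      + (if \<alpha> = 0 then ?q * (?q * (?q - 1) * h * h') else 0)" for \<alpha>
    using Y by (auto simp: X Let_def fourier_add fourier_smult fourier_const fourier_convolution
      fourier_correlation even)
  define c where "c = (?q - 1) * (fourier 0 g * fourier 0 g' + h * fourier 0 g' + h' * fourier 0 g)"
  have "g2 = (\<lambda>d. (\<Sum>s\<in>UNIV. f s * g' (d - s)) + (\<Sum>s\<in>UNIV. g s * f' (s - d)) + c)"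
    using Y by (simp add: X Let_def c_def fourier_0)
  then have g2: "fourier \<alpha> g2 = fourier \<alpha> f * fourier \<alpha> g' + fourier \<alpha> g * fourier \<alpha> f'
      + (if \<alpha> = 0 then ?q * c else 0)" for \<alpha>
    by (simp add: fourier_add fourier_const fourier_convolution fourier_correlation even)
  have h2: "h2 = h * fourier 0 f' + h' * fourier 0 f + ?q * fourier 0 g * fourier 0 g' + ?q * (?q - 2) * h * h'"
    using Y by (auto simp: X Let_def fourier_0)
  show ?thesis
  proof (cases k)
    case (ColPlus \<alpha>)
    then have "\<alpha> \<noteq> 0" using assms(3) zero_notin_S by (auto simp: columns_def)
    then show ?thesis unfolding Y unfolding X ColPlus by (simp add: f2 g2 algebra_simps power2_eq_square)
  next
    case (ColMinus \<alpha>)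
    then have "\<alpha> \<noteq> 0" using assms(3) zero_notin_S by (auto simp: columns_def)
    then show ?thesis unfolding Y unfolding X ColMinus by (simp add: f2 g2 algebra_simps power2_eq_square)
  qed (unfold Y, unfold X, simp_all add: f2 g2 h2 c_def, simp_all add: algebra_simps power2_eq_square)
qed

text \<open>
  \<open>Col0\<close>, \<open>Col1\<close> and \<open>Col2\<close> determine \<open>h\<close> and the sums of \<open>f\<close> and \<open>g\<close>; \<open>ColPlus \<alpha>\<close> and \<open>ColMinus \<alpha>\<close> determine the
  Fourier coefficients at \<open>\<alpha>\<close> and, by evenness, at \<open>- \<alpha>\<close>.
\<close>

lemma ev_inj:
  assumes X: "X \<in> even_coefs" "X' \<in> even_coefs" and eq: "\<And>k. k \<in> columns S \<Longrightarrow> ev k X = ev k X'"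
  shows "X = X'"
proof -
  obtain f g h f' g' h' where X_def: "X = (f, g, h)" "X' = (f', g', h')" by (metis prod_cases3)
  let ?q = "of_nat CARD('a) :: complex"
  have q0: "?q \<noteq> 0" by simp
  have q1: "?q + 1 \<noteq> 0" using of_nat_neq_0[of "CARD('a)", where 'a = complex] by (simp add: add.commute)
  have e0: "ev Col0 X = ev Col0 X'" and e1: "ev Col1 X = ev Col1 X'" and e2: "ev Col2 X = ev Col2 X'"
    using eq by (auto simp: columns_def)
  have "?q * (?q + 1) * fourier 0 g = ev Col0 X - ev Col2 X"
    by (simp add: X_def algebra_simps power2_eq_square)
  also have "\<dots> = ?q * (?q + 1) * fourier 0 g'"
    unfolding e0 e2 by (simp add: X_def algebra_simps power2_eq_square)
  finally have g0: "fourier 0 g = fourier 0 g'" using q0 q1 by simp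
  have "?q * ?q * h = ev Col2 X - ev Col1 X + ?q * fourier 0 g"
    by (simp add: X_def algebra_simps)
  also have "\<dots> = ?q * ?q * h'"
    unfolding e1 e2 g0 by (simp add: X_def algebra_simps)
  finally have h: "h = h'" using q0 by simp
  have f0: "fourier 0 f = fourier 0 f'" using e1 h by (simp add: X_def)
  have fg: "fourier \<alpha> f = fourier \<alpha> f' \<and> fourier \<alpha> g = fourier \<alpha> g'" if "\<alpha> \<in> S" for \<alpha>
  proof -
    have ep: "ev (ColPlus \<alpha>) X = ev (ColPlus \<alpha>) X'" and em: "ev (ColMinus \<alpha>) X = ev (ColMinus \<alpha>) X'"
      using eq that by (auto simp: columns_def)
    have "2 * fourier \<alpha> f = ev (ColPlus \<alpha>) X + ev (ColMinus \<alpha>) X" by (simp add: X_def)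
    also have "\<dots> = 2 * fourier \<alpha> f'" unfolding ep em by (simp add: X_def)
    finally have "fourier \<alpha> f = fourier \<alpha> f'" by simp
    with ep q0 show ?thesis by (simp add: X_def)
  qed
  have "fourier \<alpha> f = fourier \<alpha> f' \<and> fourier \<alpha> g = fourier \<alpha> g'" for \<alpha>
    using S_cases[of \<alpha>] fg[of \<alpha>] fg[of "- \<alpha>"] f0 g0 X
      fourier_uminus[of f \<alpha>] fourier_uminus[of g \<alpha>] fourier_uminus[of f' \<alpha>] fourier_uminus[of g' \<alpha>]
    by (auto simp: X_def even_coefs_def)
  then show ?thesis using h fourier_inj[of f f'] fourier_inj[of g g'] by (simp add: X_def)
qed

definition col_coef :: "'a col \<Rightarrow> 'a coef" where
  "col_coef k = (let v = of_nat (CARD('a)^2 * (CARD('a) + 1)) in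
     (\<lambda>x. 1 / v * Qmat p crd (Cls0 x) k, \<lambda>x. 1 / v * Qmat p crd (Cls1 x) k,
      1 / v * Qmat p crd (Cls2 :: 'a cls) k))"

lemma Qmat_uminus:
  "Qmat p crd (Cls0 (- x)) k = Qmat p crd (Cls0 x) k"
  "Qmat p crd (Cls1 (- x)) k = Qmat p crd (Cls1 x) k"
  by (cases k; simp flip: chi_minus_left add: add.commute)+

lemma col_coef_even: "col_coef k \<in> even_coefs"
  by (simp add: col_coef_def even_coefs_def Let_def Qmat_uminus)

text \<open>
  The columns \<open>Col0\<close>, \<open>Col1\<close>, \<open>Col2\<close> have constant blocks, visible to the trivial character only, and
  by orthogonality \<open>\<chi>\<^sub>\<alpha> + \<chi>\<^bsub>-\<alpha>\<^esub>\<close> is visible, among the characters with index in \<open>S \<union> {0}\<close>, to \<open>\<chi>\<^sub>\<alpha>\<close> only.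
\<close>

lemma ev_col_coef:
  assumes jk: "j \<in> columns S" "k \<in> columns S"
  shows "ev j (col_coef k) = of_bool (j = k)"
proof -
  let ?q = "of_nat CARD('a) :: complex"
  let ?v = "of_nat (CARD('a)^2 * (CARD('a) + 1)) :: complex"
  have q0: "?q \<noteq> 0" by simp
  have q1: "?q + 1 \<noteq> 0" using of_nat_neq_0[of "CARD('a)", where 'a = complex] by (simp add: add.commute)
  have v: "?v = ?q^2 * (?q + 1)" by (simp add: algebra_simps)
  have scaled: "ev j (\<lambda>x. c * f x, \<lambda>x. c * g x, c * h) = c * ev j (f, g, h)" for c f g h
    by (cases j) (simp_all add: fourier_smult algebra_simps)
  have pair: "fourier \<beta> (\<lambda>x. c * (\<chi> \<alpha> x + \<chi> (- \<alpha>) x)) = (if \<beta> = \<alpha> then c * ?q else 0)"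
    if "\<alpha> \<in> S" "\<beta> \<in> insert 0 S" for \<alpha> \<beta> c
  proof -
    have "\<beta> \<noteq> - \<alpha>" using that uminus_S zero_notin_S by auto
    then show ?thesis by (simp add: fourier_smult fourier_add fourier_chi)
  qed
  have nz: "\<alpha> \<noteq> 0" if "\<alpha> \<in> S" for \<alpha> using that zero_notin_S by auto
  define f where "f = (\<lambda>x. Qmat p crd (Cls0 x) k)"
  define g where "g = (\<lambda>x. Qmat p crd (Cls1 x) k)"
  have F0: "fourier \<beta> f = (case k of
      Col0 \<Rightarrow> if \<beta> = 0 then ?q else 0
    | Col1 \<Rightarrow> if \<beta> = 0 then ?q * (?q^2 - 1) else 0
    | Col2 \<Rightarrow> if \<beta> = 0 then ?q * ?q else 0
    | ColPlus \<alpha> \<Rightarrow> if \<beta> = \<alpha> then ?q * (?q + 1) / 2 * ?q else 0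
    | ColMinus \<alpha> \<Rightarrow> if \<beta> = \<alpha> then ?q * (?q + 1) / 2 * ?q else 0)"
    if "\<beta> \<in> insert 0 S" for \<beta>
    proof (cases k)
      case (ColPlus \<alpha>)
      then have "\<alpha> \<in> S" using jk(2) by (auto simp: columns_def)
      from pair[OF this that] show ?thesis by (simp only: f_def ColPlus Qmat.simps col.case)
    next
      case (ColMinus \<alpha>)
      then have "\<alpha> \<in> S" using jk(2) by (auto simp: columns_def)
      from pair[OF this that] show ?thesis by (simp only: f_def ColMinus Qmat.simps col.case)
    qed (simp_all add: f_def fourier_const)
  have F1: "fourier \<beta> g = (case k of
      Col0 \<Rightarrow> if \<beta> = 0 then ?q else 0
    | Col1 \<Rightarrow> 0
    | Col2 \<Rightarrow> if \<beta> = 0 then - ?q else 0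
    | ColPlus \<alpha> \<Rightarrow> if \<beta> = \<alpha> then (?q + 1) / 2 * ?q else 0
    | ColMinus \<alpha> \<Rightarrow> if \<beta> = \<alpha> then - ((?q + 1) / 2) * ?q else 0)"
    if "\<beta> \<in> insert 0 S" for \<beta>
    proof (cases k)
      case (ColPlus \<alpha>)
      then have "\<alpha> \<in> S" using jk(2) by (auto simp: columns_def)
      from pair[OF this that] show ?thesis by (simp only: g_def ColPlus Qmat.simps col.case)
    next
      case (ColMinus \<alpha>)
      then have "\<alpha> \<in> S" using jk(2) by (auto simp: columns_def)
      from pair[OF this that] show ?thesis by (simp only: g_def ColMinus Qmat.simps col.case)
    qed (simp_all add: g_def fourier_const)
  have E: "ev j (\<lambda>x. Qmat p crd (Cls0 x) k, \<lambda>x. Qmat p crd (Cls1 x) k, Qmat p crd Cls2 k)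
      = (if j = k then ?v else 0)"
    using jk unfolding v columns_def
    unfolding f_def[symmetric] g_def[symmetric]
    by (cases j; cases k) (auto simp: F0 F1 dest: nz, simp_all add: field_simps power2_eq_square)
  have "?v \<noteq> 0" unfolding v using q0 q1 by simp
  then show ?thesis
    unfolding col_coef_def Let_def scaled E
    by (cases "j = k") (simp_all del: of_nat_mult of_nat_add of_nat_power)
qed


section \<open>The adjacency algebra\<close>

lemma class_mat_eq:
  assumes "l \<in> scheme_index S"
  shows "class_mat p crd L l = coef_mat (class_coef l)"
proof -
  have neq: "\<alpha> \<noteq> - \<alpha>" if "\<alpha> \<in> S" for \<alpha> using uminus_S[OF that] that by metis
  have [simp]: "(\<lambda>x. of_bool (x = \<alpha>) + of_bool (x = - \<alpha>) :: complex) = (\<lambda>x. of_bool (x = \<alpha> \<or> x = - \<alpha>))"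
    if "\<alpha> \<in> S" for \<alpha>
    using neq[OF that] by (intro ext) auto
  show ?thesis
    using assms by (auto simp: scheme_index_def A0_eq_coef_mat A1_eq_coef_mat A2_eq_coef_mat coef_mat_add)
qed

text \<open>
  \<open>S \<union> {0}\<close> is a set of representatives modulo sign, so every function on it has a unique even extension
  to the field.
\<close>

definition even_extension :: "('a \<Rightarrow> complex) \<Rightarrow> 'a \<Rightarrow> complex" where
  "even_extension \<phi> x = (if x \<in> insert 0 S then \<phi> x else \<phi> (- x))"

lemma even_extension_even [simp]: "(\<And>x. f (- x) = f x) \<Longrightarrow> even_extension f = f"
  by (auto simp: even_extension_def)

lemma even_extension_uminus: "even_extension \<phi> (- x) = even_extension \<phi> x"
  using S_cases[of x] uminus_S[of x] uminus_S[of "- x"] zero_notin_S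
  by (auto simp: even_extension_def)

lemma even_extension_sum:
  "(\<Sum>a\<in>insert 0 S. \<phi> a * of_bool (x = a \<or> x = - a)) = even_extension \<phi> x"
proof -
  define r where "r = (if x \<in> insert 0 S then x else - x)"
  have r: "r \<in> insert 0 S" using S_cases[of x] by (auto simp: r_def)
  have "x = a \<or> x = - a \<longleftrightarrow> a = r" if "a \<in> insert 0 S" for a
    using that uminus_S[of a] zero_notin_S by (auto simp: r_def)
  then have "(\<Sum>a\<in>insert 0 S. \<phi> a * of_bool (x = a \<or> x = - a)) = (\<Sum>a\<in>insert 0 S. if a = r then \<phi> r else 0)"
    by (intro sum.cong) auto
  also have "\<dots> = \<phi> r" using r by (subst sum.delta) auto
  finally show ?thesis by (simp add: r_def even_extension_def)
qed

lemma sum_scheme_index: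
  "(\<Sum>l\<in>scheme_index S. F l) = (\<Sum>a\<in>insert 0 S. F (Cls0 a)) + (\<Sum>a\<in>insert 0 S. F (Cls1 a)) + (F Cls2 :: complex)"
proof -
  have "(\<Sum>l\<in>scheme_index S. F l) = sum F (Cls0 ` insert 0 S) + sum F (Cls1 ` insert 0 S) + sum F {Cls2}"
    unfolding scheme_index_def by (subst sum.union_disjoint; (subst sum.union_disjoint)?) auto
  then show ?thesis by (simp add: sum.reindex inj_on_def del: image_insert)
qed

lemma lincomb_class_mat:
  "mat_lincomb (CARD('a)^2 * (CARD('a) + 1)) (scheme_index S) c (class_mat p crd L)
    = coef_mat (even_extension (\<lambda>a. c (Cls0 a)), even_extension (\<lambda>a. c (Cls1 a)), c Cls2)"
proof -
  let ?v = "CARD('a)^2 * (CARD('a) + 1)"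
  have "mat_lincomb ?v (scheme_index S) c (class_mat p crd L)
      = mat ?v ?v (\<lambda>(i, j). \<Sum>l\<in>scheme_index S. c l * kern (class_coef l) (point i) (point j))"
    unfolding mat_lincomb_def by (rule cong_mat) (auto simp: class_mat_eq coef_mat_def intro!: sum.cong)
  also have "\<dots> = coef_mat (even_extension (\<lambda>a. c (Cls0 a)), even_extension (\<lambda>a. c (Cls1 a)), c Cls2)"
    unfolding kern_lincomb coef_mat_def by (simp add: sum_scheme_index even_extension_sum del: sum.insert sum.insert_if)
  finally show ?thesis .
qed

lemma adjacency_algebra_eq:
  "adjacency_algebra (CARD('a)^2 * (CARD('a) + 1)) (scheme_index S) (class_mat p crd L) = coef_mat ` even_coefs"
proof
  show "adjacency_algebra (CARD('a)^2 * (CARD('a) + 1)) (scheme_index S) (class_mat p crd L) \<subseteq> coef_mat ` even_coefs"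
  proof
    fix A assume "A \<in> adjacency_algebra (CARD('a)^2 * (CARD('a) + 1)) (scheme_index S) (class_mat p crd L)"
    then obtain c where "A = coef_mat (even_extension (\<lambda>a. c (Cls0 a)), even_extension (\<lambda>a. c (Cls1 a)), c Cls2)"
      unfolding adjacency_algebra_def lincomb_class_mat by blast
    then show "A \<in> coef_mat ` even_coefs" by (simp add: even_coefs_def even_extension_uminus)
  qed
  show "coef_mat ` even_coefs \<subseteq> adjacency_algebra (CARD('a)^2 * (CARD('a) + 1)) (scheme_index S) (class_mat p crd L)"
  proof
    fix A assume "A \<in> coef_mat ` even_coefs"
    then obtain f g h where A: "A = coef_mat (f, g, h)" "\<And>x. f (- x) = f x" "\<And>x. g (- x) = g x"
      by (auto simp: even_coefs_def)
    then have "A = mat_lincomb (CARD('a)^2 * (CARD('a) + 1)) (scheme_index S)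
        (\<lambda>l. case l of Cls0 a \<Rightarrow> f a | Cls1 a \<Rightarrow> g a | Cls2 \<Rightarrow> h) (class_mat p crd L)"
      unfolding lincomb_class_mat by simp
    then show "A \<in> adjacency_algebra (CARD('a)^2 * (CARD('a) + 1)) (scheme_index S) (class_mat p crd L)"
      unfolding adjacency_algebra_def by blast
  qed
qed

lemma coef_mat_symmetric:
  assumes "X \<in> even_coefs"
  shows "transpose_mat (coef_mat X) = coef_mat X"
proof (rule eq_matI)
  obtain f g h where X: "X = (f, g, h)" by (metis prod_cases3)
  fix i j assume "i < dim_row (coef_mat X)" "j < dim_col (coef_mat X)"
  then have ij: "i < CARD('a)^2 * (CARD('a) + 1)" "j < CARD('a)^2 * (CARD('a) + 1)"
    by (simp_all add: coef_mat_def)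
  obtain u b y u' b' y' where pt: "point i = (u, b, y)" "u \<le> CARD('a)" "point j = (u', b', y')" "u' \<le> CARD('a)"
    using point_cases[OF ij(1)] point_cases[OF ij(2)] by metis
  show "transpose_mat (coef_mat X) $$ (i, j) = coef_mat X $$ (i, j)"
    using assms ij kern_symmetric[OF pt(2,4), of f g h b y b' y'] by (simp add: coef_mat_def pt X even_coefs_def)
qed (simp_all add: coef_mat_def)

lemma class_coef_even: "class_coef l \<in> even_coefs"
  by (cases l) (auto simp: even_coefs_def minus_equation_iff)

lemma coef_mat_one: "coef_mat (class_coef (Cls0 0)) = 1\<^sub>m (CARD('a)^2 * (CARD('a) + 1))"
proof (rule eq_matI)
  fix i j assume "i < dim_row (1\<^sub>m (CARD('a)^2 * (CARD('a) + 1)) :: complex mat)"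
    "j < dim_col (1\<^sub>m (CARD('a)^2 * (CARD('a) + 1)) :: complex mat)"
  then have ij: "i < CARD('a)^2 * (CARD('a) + 1)" "j < CARD('a)^2 * (CARD('a) + 1)" by simp_all
  have "kern (class_coef (Cls0 0)) s t = of_bool (s = t)" for s t
    by (cases s; cases t) auto
  moreover have "point i = point j \<longleftrightarrow> i = j"
    using bij_point ij unfolding bij_betw_def by (auto dest: inj_onD)
  ultimately show "coef_mat (class_coef (Cls0 0)) $$ (i, j) = 1\<^sub>m (CARD('a)^2 * (CARD('a) + 1)) $$ (i, j)"
    using ij by (simp add: coef_mat_def)
qed (simp_all add: coef_mat_def)

section \<open>The scheme and its second eigenmatrix\<close>

lemma symmetric_scheme:
  "symmetric_association_scheme (CARD('a)^2 * (CARD('a) + 1)) (scheme_index S) (Cls0 0) (class_mat p crd L)"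
  unfolding symmetric_association_scheme_def association_scheme_def
proof (intro conjI ballI)
  let ?v = "CARD('a)^2 * (CARD('a) + 1)"
  show "finite (scheme_index S)" "Cls0 0 \<in> scheme_index S" by (simp_all add: scheme_index_def)
  then show "class_mat p crd L (Cls0 0) = 1\<^sub>m ?v" by (simp only: class_mat_eq coef_mat_one)
  have "kern (\<lambda>_. 1, \<lambda>_. 1, 1) s t = 1" for s t by (cases s; cases t) auto
  then show "mat_lincomb ?v (scheme_index S) (\<lambda>_. 1) (class_mat p crd L) = all_ones ?v"
    unfolding lincomb_class_mat coef_mat_def all_ones_def by (simp add: split_def)
next
  let ?v = "CARD('a)^2 * (CARD('a) + 1)"
  fix l assume l: "l \<in> scheme_index S"
  show "class_mat p crd L l \<in> carrier_mat ?v ?v" by (simp only: class_mat_eq[OF l] coef_mat_carrier)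
  show "class_mat p crd L l \<noteq> 0\<^sub>m ?v ?v"
  proof
    assume "class_mat p crd L l = 0\<^sub>m ?v ?v"
    then have "class_coef l = (\<lambda>_. 0, \<lambda>_. 0, 0)"
      unfolding class_mat_eq[OF l] coef_mat_zero by (rule coef_mat_inj)
    then show False by (cases l) (auto simp: fun_eq_iff)
  qed
  have "kern (class_coef l) s t = 0 \<or> kern (class_coef l) s t = 1" for s t
    by (cases l; cases s; cases t) auto
  then show "\<forall>r<?v. \<forall>s<?v. class_mat p crd L l $$ (r, s) = 0 \<or> class_mat p crd L l $$ (r, s) = 1"
    by (simp add: class_mat_eq[OF l] coef_mat_def)
  show sym: "transpose_mat (class_mat p crd L l) = class_mat p crd L l"
    by (simp only: class_mat_eq[OF l] coef_mat_symmetric class_coef_even)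
  fix l' assume l': "l' \<in> scheme_index S"
  show "class_mat p crd L l * class_mat p crd L l' \<in> adjacency_algebra ?v (scheme_index S) (class_mat p crd L)"
    unfolding adjacency_algebra_eq class_mat_eq[OF l] class_mat_eq[OF l'] coef_mat_mult
    by (intro imageI coef_mult_even class_coef_even)
next
  fix l assume "l \<in> scheme_index S - {Cls0 0}"
  moreover from this have "transpose_mat (class_mat p crd L l) = class_mat p crd L l"
    by (simp add: class_mat_eq coef_mat_symmetric class_coef_even)
  ultimately show "\<exists>j\<in>scheme_index S - {Cls0 0}. transpose_mat (class_mat p crd L l) = class_mat p crd L j"
    by blast
qed

lemma second_eigenmatrix_Qmat:
  "second_eigenmatrix (CARD('a)^2 * (CARD('a) + 1)) (scheme_index S) (class_mat p crd L) (columns S) (Qmat p crd)"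
  unfolding second_eigenmatrix_def
proof (intro exI conjI ballI)
  let ?v = "CARD('a)^2 * (CARD('a) + 1)"
  show "bij_betw (\<lambda>k. coef_mat (col_coef k)) (columns S)
    {X. primitive_idempotent ?v (adjacency_algebra ?v (scheme_index S) (class_mat p crd L)) X}"
    unfolding adjacency_algebra_eq
  proof (rule primitive_idempotents_of_split_algebra[where ev = ev])
    fix X Y :: "'a coef" assume X: "X \<in> even_coefs" and Y: "Y \<in> even_coefs"
    obtain f g h f' g' h' where XY: "X = (f, g, h)" "Y = (f', g', h')" by (metis prod_cases3)
    show "\<exists>Z\<in>even_coefs. coef_mat X * coef_mat Y = coef_mat Z \<and> (\<forall>k\<in>columns S. ev k Z = ev k X * ev k Y)"
      using coef_mat_mult coef_mult_even[OF X Y] ev_mult[OF X Y] by blast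
    have "ev k (\<lambda>x. f x + f' x, \<lambda>x. g x + g' x, h + h') = ev k X + ev k Y" for k
      by (cases k) (simp_all add: XY fourier_add algebra_simps)
    moreover have "(\<lambda>x. f x + f' x, \<lambda>x. g x + g' x, h + h') \<in> even_coefs"
      using X Y by (simp add: XY even_coefs_def)
    ultimately show "\<exists>Z\<in>even_coefs. coef_mat X + coef_mat Y = coef_mat Z \<and> (\<forall>k\<in>columns S. ev k Z = ev k X + ev k Y)"
      using coef_mat_add unfolding XY by blast
    have "ev k (\<lambda>x. f x + (- 1) * f' x, \<lambda>x. g x + (- 1) * g' x, h + (- 1) * h') = ev k X - ev k Y" for k
      by (cases k) (simp_all only: XY ev.simps fourier_add fourier_smult, simp_all add: algebra_simps)
    moreover have "(\<lambda>x. f x + (- 1) * f' x, \<lambda>x. g x + (- 1) * g' x, h + (- 1) * h') \<in> even_coefs"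
      using X Y by (simp add: XY even_coefs_def)
    ultimately show "\<exists>Z\<in>even_coefs. \<forall>k\<in>columns S. ev k Z = ev k X - ev k Y"
      by blast
    show "coef_mat X = coef_mat Y \<longleftrightarrow> (\<forall>k\<in>columns S. ev k X = ev k Y)"
      using coef_mat_inj ev_inj[OF X Y] by blast
  next
    have "ev k (\<lambda>_. 0, \<lambda>_. 0, 0) = 0" for k
      by (cases k) (simp_all add: fourier_const)
    moreover have "(\<lambda>_. 0, \<lambda>_. 0, 0) \<in> (even_coefs :: 'a coef set)" by (simp add: even_coefs_def)
    ultimately show "\<exists>Z\<in>even_coefs. 0\<^sub>m ?v ?v = coef_mat Z \<and> (\<forall>k\<in>columns S. ev k Z = 0)"
      using coef_mat_zero by blast
  qed (simp_all add: col_coef_even ev_col_coef)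
  fix k
  show "coef_mat (col_coef k) = (1 / of_nat ?v) \<cdot>\<^sub>m
      mat_lincomb ?v (scheme_index S) (\<lambda>l. Qmat p crd l k) (class_mat p crd L)"
    by (simp only: lincomb_class_mat even_extension_even Qmat_uminus coef_mat_smult col_coef_def Let_def)
qed

end

theorem corollary5p8:
  fixes p m q :: nat
    and crd :: "'a::{field,finite} \<Rightarrow> nat list"
    and L :: "'a option mat"
    and S :: "'a set"
  assumes "prime p" and "odd p" and "m \<ge> 1" and "q = p ^ m"
    and "CARD('a) = q"
    and "additive_coords p m crd"
    and "latin_square (q + 1) L"
    and "transpose_mat L = L"
    and "\<And>i. i < q + 1 \<Longrightarrow> L $$ (i, i) = None"
    and "S \<union> uminus ` S = UNIV - {0}"
    and "S \<inter> uminus ` S = {}"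
  shows "symmetric_association_scheme (q^2 * (q + 1)) (scheme_index S) (Cls0 0) (class_mat p crd L)
    \<and> second_eigenmatrix (q^2 * (q + 1)) (scheme_index S) (class_mat p crd L) (columns S) (Qmat p crd)"
proof -
  interpret symmetrized_scheme p m crd L S
    using assms prime_gt_1_nat by unfold_locales auto
  show ?thesis using symmetric_scheme second_eigenmatrix_Qmat assms(5) by simp
qed

end
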